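(* Let $\mathcal{A}$ be a fermion lattice system on an infinite countable lattice $\Gamma$, and let $\Phi$ be an even potential such that for every finite $\mathrm{I}\subset\Gamma$ the surface energy $H_{\partial\mathrm{I}}$ exists as an element of $\mathcal{A}$. Suppose a state $\varphi$ of $\mathcal{A}$ satisfies the local thermodynamical stability (LTS) condition with respect to $\Phi$ at inverse temperature $\beta>0$, and assume further that $\varphi$ is even. Let $\mathrm{A}$ be an arbitrary finite subset of $\Gamma$. Then for any (finite or infinite) region $\mathrm{B}\subset\mathrm{A}^c$, $$I_{\varphi}(\mathrm{A}:\mathrm{B})\le I_{\varphi}(\mathrm{A}:\mathrm{A}^c)\le\beta\,(\varphi_{\mathrm{A}}\otimes_{\mathrm{car}}\varphi_{\mathrm{A}^c}-\varphi)(H_{\partial\mathrm{A}})\le 2\beta\lVert H_{\partial\mathrm{A}}\rVert.$$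
   Context: Fermion lattice system: $\mathcal{A}$ is the CAR $C^*$-algebra generated by $c_i,c_i^*$ ($i\in\Gamma$) with $\{c_i^*,c_j\}=\delta_{ij}\mathbf{1}$, $\{c_i,c_j\}=\{c_i^*,c_j^*\}=0$; for $\mathrm{I}\subset\Gamma$, $\mathcal{A}(\mathrm{I})$ is the $C^*$-subalgebra generated by $c_i,c_i^*$, $i\in\mathrm{I}$ (a matrix algebra $M_{2^{|\mathrm{I}|}}(\mathbb{C})$ for finite $\mathrm{I}$). The grading $\Theta$ is the automorphism with $\Theta(c_i)=-c_i$; a state is even if $\psi\circ\Theta=\psi$; $\mathcal{A}(\mathrm{I})_+$ denotes the $\Theta$-fixed elements of $\mathcal{A}(\mathrm{I})$. For states $\psi_1$ on $\mathcal{A}(\mathrm{I})$ and $\psi_2$ on $\mathcal{A}(\mathrm{I}^c)$ with at least one even, $\psi_1\otimes_{\mathrm{car}}\psi_2$ is the unique state $\omega$ on $\mathcal{A}$ with $\omega(XY)=\psi_1(X)\psi_2(Y)$ for $X\in\mathcal{A}(\mathrm{I})$, $Y\in\mathcal{A}(\mathrm{I}^c)$. Entropies: for finite $\mathrm{I}$, $S_{\mathrm{I}}(\psi)$ is the von Neumann entropy of $\psi|_{\mathcal{A}(\mathrm{I})}$ (density matrix w.r.t. matrix trace); for $\mathrm{J}\subset\mathrm{I}^c$, $\widetilde S_{\mathrm{I}|\mathrm{J}}(\psi)=\inf_{\Lambda\subset\mathrm{J}\text{ finite}}\{S_{\mathrm{I}\cup\Lambda}(\psi)-S_\Lambda(\psi)\}$,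 $\widetilde S_{\mathrm{I}}=\widetilde S_{\mathrm{I}|\mathrm{I}^c}$, and $I_\psi(\mathrm{I}:\mathrm{J})=S_{\mathrm{I}}(\psi)-\widetilde S_{\mathrm{I}|\mathrm{J}}(\psi)$. An even potential is a map $\Phi$ from finite $\mathrm{K}\subset\Gamma$ with $\Phi(\mathrm{K})^*=\Phi(\mathrm{K})\in\mathcal{A}(\mathrm{K})_+$. For finite $\mathrm{I}$: $H_{\mathrm{I}}=\sum_{\mathrm{K}\subset\mathrm{I}}\Phi(\mathrm{K})$, $H_{\partial\mathrm{I}}=\sum_{\mathrm{K}\cap\mathrm{I}\ne\emptyset,\mathrm{K}\cap\mathrm{I}^c\neq\emptyset}\Phi(\mathrm{K})$, $\widetilde H_{\mathrm{I}}=H_{\mathrm{I}}+H_{\partial\mathrm{I}}$, $\widetilde F_{\mathrm{I}}(\psi)=\psi(\widetilde H_{\mathrm{I}})-\frac1\beta\widetilde S_{\mathrm{I}}(\psi)$. LTS: for each finite $\mathrm{I}$, $\widetilde F_{\mathrm{I}}(\varphi)\le\widetilde F_{\mathrm{I}}(\psi)$ for every state $\psi$ of $\mathcal{A}$ agreeing with $\varphi$ on $\mathcal{A}(\mathrm{I}^c)$. *)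

theory Defs
  imports "HOL-Analysis.Analysis" "HOL-Library.Multiset" "HOL-Library.Countable"
begin

text \<open>Each site i carries two self-adjoint Majorana generators
  gamma_(i,False) = c_i + c_i^* and gamma_(i,True) = i (c_i^* - c_i), which satisfy
  {gamma_p, gamma_q} = 2 delta_pq.  Conversely c_i = (gamma_(i,False) + i gamma_(i,True))/2,
  so both families generate the same algebra.  The monomials gamma_S = gamma_(s1)...gamma_(sk)
  (s1 < ... < sk for a fixed enumeration of the Majorana indices, S finite) form a linear basis
  of the algebraic (local) CAR algebra.  An element is represented by its coefficient
  function S |-> coefficient of gamma_S; local elements are those supported on finitely
  many sites.  The CAR C*-algebra is the norm completion of the local algebra; elements of
  the completion enter only through limits below.\<close>

type_synonym 'g car = "('g \<times> bool) set \<Rightarrow> complex"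

definition symdiff :: "'a set \<Rightarrow> 'a set \<Rightarrow> 'a set" where
  "symdiff S T = (S - T) \<union> (T - S)"

text \<open>gamma_S gamma_T = csgn S T * gamma_(S symdiff T)\<close>
definition csgn :: "('g::countable \<times> bool) set \<Rightarrow> ('g \<times> bool) set \<Rightarrow> complex" where
  "csgn S T = (-1) ^ card {(s, t). s \<in> S \<and> t \<in> T \<and> to_nat t < to_nat s}"

definition cmul :: "'g::countable car \<Rightarrow> 'g car \<Rightarrow> 'g car" where
  "cmul f g = (\<lambda>U. \<Sum>S\<in>{S. f S \<noteq> 0}. f S * g (symdiff S U) * csgn S (symdiff S U))"

definition cadd :: "'g car \<Rightarrow> 'g car \<Rightarrow> 'g car" where
  "cadd f g = (\<lambda>S. f S + g S)"

definition cdiff :: "'g car \<Rightarrow> 'g car \<Rightarrow> 'g car" where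
  "cdiff f g = (\<lambda>S. f S - g S)"

definition cscale :: "complex \<Rightarrow> 'g car \<Rightarrow> 'g car" where
  "cscale c f = (\<lambda>S. c * f S)"

definition cone :: "'g car" where
  "cone = (\<lambda>S. if S = {} then 1 else 0)"

definition csum :: "'i set \<Rightarrow> ('i \<Rightarrow> 'g car) \<Rightarrow> 'g car" where
  "csum F h = (\<lambda>S. \<Sum>k\<in>F. h k S)"

definition cpow :: "'g::countable car \<Rightarrow> nat \<Rightarrow> 'g car" where
  "cpow x n = ((cmul x) ^^ n) cone"

text \<open>gamma_S^* = (-1)^(k(k-1)/2) gamma_S for |S| = k\<close>
definition cadj :: "'g car \<Rightarrow> 'g car" where
  "cadj f = (\<lambda>S. cnj (f S) * (-1) ^ (card S * (card S - 1) div 2))"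

definition annih :: "'g \<Rightarrow> 'g car" where
  "annih i = (\<lambda>S. if S = {(i, False)} then 1/2 else if S = {(i, True)} then \<i>/2 else 0)"

text \<open>Grading automorphism Theta (c_i |-> -c_i), i.e. gamma_S |-> (-1)^|S| gamma_S.\<close>
definition grading :: "'g car \<Rightarrow> 'g car" where
  "grading f = (\<lambda>S. (-1) ^ card S * f S)"

definition even_elem :: "'g car \<Rightarrow> bool" where
  "even_elem f \<longleftrightarrow> grading f = f"

definition supp_in :: "'g set \<Rightarrow> 'g car \<Rightarrow> bool" where
  "supp_in I f \<longleftrightarrow> (\<forall>S. f S \<noteq> 0 \<longrightarrow> S \<subseteq> I \<times> UNIV)"

definition loc :: "'g car \<Rightarrow> bool" where
  "loc f \<longleftrightarrow> (\<exists>\<Lambda>. finite \<Lambda> \<and> supp_in \<Lambda> f)"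

text \<open>in_alg I f: f is a local element of A(I); these are norm dense in A(I).\<close>
definition in_alg :: "'g set \<Rightarrow> 'g car \<Rightarrow> bool" where
  "in_alg I f \<longleftrightarrow> loc f \<and> supp_in I f"

text \<open>Unique tracial state tau(gamma_S) = [S = {}].\<close>
definition tau :: "'g car \<Rightarrow> complex" where
  "tau f = f {}"

text \<open>C*-norm of a local element: operator norm in the GNS representation of the tracial
  state (faithful, since the CAR algebra is simple).\<close>
definition cnorm :: "'g::countable car \<Rightarrow> real" where
  "cnorm x = Sup {sqrt (Re (tau (cmul (cadj (cmul x y)) (cmul x y)))) | y.
                   loc y \<and> Re (tau (cmul (cadj y) y)) \<le> 1}"

text \<open>A state of A is determined by (and uniquely extends from) its values on the dense
  local *-subalgebra; we normalise it to 0 outside the local algebra.\<close>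
definition state :: "('g::countable car \<Rightarrow> complex) \<Rightarrow> bool" where
  "state \<omega> \<longleftrightarrow>
     (\<forall>x y. loc x \<longrightarrow> loc y \<longrightarrow> \<omega> (cadd x y) = \<omega> x + \<omega> y) \<and>
     (\<forall>c x. loc x \<longrightarrow> \<omega> (cscale c x) = c * \<omega> x) \<and>
     \<omega> cone = 1 \<and>
     (\<forall>x. loc x \<longrightarrow> Im (\<omega> (cmul (cadj x) x)) = 0 \<and> Re (\<omega> (cmul (cadj x) x)) \<ge> 0) \<and>
     (\<forall>x. \<not> loc x \<longrightarrow> \<omega> x = 0)"

definition even_state :: "('g car \<Rightarrow> complex) \<Rightarrow> bool" where
  "even_state \<omega> \<longleftrightarrow> (\<forall>x. loc x \<longrightarrow> \<omega> (grading x) = \<omega> x)"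

definition car_prod :: "'g set \<Rightarrow> ('g::countable car \<Rightarrow> complex) \<Rightarrow> ('g car \<Rightarrow> complex)
                          \<Rightarrow> ('g car \<Rightarrow> complex)" where
  "car_prod I \<psi>1 \<psi>2 = (THE \<omega>. state \<omega> \<and>
      (\<forall>X Y. in_alg I X \<longrightarrow> in_alg (- I) Y \<longrightarrow> \<omega> (cmul X Y) = \<psi>1 X * \<psi>2 Y))"

text \<open>Matrix trace on A(I) = M_(2^|I|)(C), for finite I.\<close>
definition mtrace :: "'g set \<Rightarrow> 'g car \<Rightarrow> complex" where
  "mtrace I x = of_nat (2 ^ card I) * tau x"

definition dens :: "('g::countable car \<Rightarrow> complex) \<Rightarrow> 'g set \<Rightarrow> 'g car" where
  "dens \<psi> I = (THE \<rho>. in_alg I \<rho> \<and> (\<forall>x. in_alg I x \<longrightarrow> \<psi> x = mtrace I (cmul \<rho> x)))"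

text \<open>Multiset of eigenvalues (with multiplicity) of the density matrix, characterised by
  all its moments tr(rho^n), n = 0,1,2,... (n = 0 fixes the size 2^|I|).\<close>
definition dens_spec :: "('g::countable car \<Rightarrow> complex) \<Rightarrow> 'g set \<Rightarrow> real multiset" where
  "dens_spec \<psi> I = (THE M. \<forall>n. mtrace I (cpow (dens \<psi> I) n)
                                  = of_real (sum_mset (image_mset (\<lambda>l. l ^ n) M)))"

definition vN_entropy :: "('g::countable car \<Rightarrow> complex) \<Rightarrow> 'g set \<Rightarrow> real" where
  "vN_entropy \<psi> I = sum_mset (image_mset (\<lambda>l. if l = 0 then 0 else - l * ln l) (dens_spec \<psi> I))"

definition cond_entropy :: "('g::countable car \<Rightarrow> complex) \<Rightarrow> 'g set \<Rightarrow> 'g set \<Rightarrow> real" where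
  "cond_entropy \<psi> I J = (INF \<Lambda>\<in>{\<Lambda>. finite \<Lambda> \<and> \<Lambda> \<subseteq> J}. vN_entropy \<psi> (I \<union> \<Lambda>) - vN_entropy \<psi> \<Lambda>)"

definition mutual_info :: "('g::countable car \<Rightarrow> complex) \<Rightarrow> 'g set \<Rightarrow> 'g set \<Rightarrow> real" where
  "mutual_info \<psi> I J = vN_entropy \<psi> I - cond_entropy \<psi> I J"

definition even_potential :: "('g set \<Rightarrow> 'g::countable car) \<Rightarrow> bool" where
  "even_potential \<Phi> \<longleftrightarrow> (\<forall>K. finite K \<longrightarrow>
      in_alg K (\<Phi> K) \<and> cadj (\<Phi> K) = \<Phi> K \<and> even_elem (\<Phi> K))"

definition H_loc :: "('g set \<Rightarrow> 'g car) \<Rightarrow> 'g set \<Rightarrow> 'g car" where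
  "H_loc \<Phi> I = csum (Pow I) \<Phi>"

definition bd_sets :: "'g set \<Rightarrow> 'g set set" where
  "bd_sets I = {K. finite K \<and> K \<inter> I \<noteq> {} \<and> K \<inter> (- I) \<noteq> {}}"

text \<open>H_(bd I) exists as an element of A: the net of finite partial sums of
  sum_(K in bd_sets I) Phi(K) converges (equivalently, is Cauchy) in the C*-norm.\<close>
definition bd_exists :: "('g set \<Rightarrow> 'g::countable car) \<Rightarrow> 'g set \<Rightarrow> bool" where
  "bd_exists \<Phi> I \<longleftrightarrow> (\<forall>e>0. \<exists>F0. finite F0 \<and> F0 \<subseteq> bd_sets I \<and>
      (\<forall>F1 F2. finite F1 \<and> F0 \<subseteq> F1 \<and> F1 \<subseteq> bd_sets I \<and> finite F2 \<and> F0 \<subseteq> F2 \<and> F2 \<subseteq> bd_sets I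
         \<longrightarrow> cnorm (cdiff (csum F1 \<Phi>) (csum F2 \<Phi>)) < e))"

definition state_bd :: "('g set \<Rightarrow> 'g car) \<Rightarrow> ('g car \<Rightarrow> complex) \<Rightarrow> 'g set \<Rightarrow> complex" where
  "state_bd \<Phi> \<psi> I = Lim (finite_subsets_at_top (bd_sets I)) (\<lambda>F. \<psi> (csum F \<Phi>))"

definition norm_bd :: "('g set \<Rightarrow> 'g::countable car) \<Rightarrow> 'g set \<Rightarrow> real" where
  "norm_bd \<Phi> I = Lim (finite_subsets_at_top (bd_sets I)) (\<lambda>F. cnorm (csum F \<Phi>))"

text \<open>F~_I(psi) = psi(H_I + H_(bd I)) - S~_I(psi)/beta (psi of a self-adjoint element is real).\<close>
definition free_energy :: "('g set \<Rightarrow> 'g::countable car) \<Rightarrow> real \<Rightarrow> 'g set \<Rightarrow> ('g car \<Rightarrow> complex) \<Rightarrow> real" where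
  "free_energy \<Phi> \<beta> I \<psi> = Re (\<psi> (H_loc \<Phi> I)) + Re (state_bd \<Phi> \<psi> I) - cond_entropy \<psi> I (- I) / \<beta>"

definition LTS :: "('g set \<Rightarrow> 'g::countable car) \<Rightarrow> real \<Rightarrow> ('g car \<Rightarrow> complex) \<Rightarrow> bool" where
  "LTS \<Phi> \<beta> \<phi> \<longleftrightarrow> (\<forall>I. finite I \<longrightarrow> (\<forall>\<psi>. state \<psi> \<and> (\<forall>x. in_alg (- I) x \<longrightarrow> \<psi> x = \<phi> x)
        \<longrightarrow> free_energy \<Phi> \<beta> I \<phi> \<le> free_energy \<Phi> \<beta> I \<psi>))"

end

theory Submission
  imports Defs "HOL-Computational_Algebra.Fundamental_Theorem_Algebra"
begin

text \<open>
  Stability is tested against \<omega> = \<phi>_A \<otimes> \<phi>_(A^c), which agrees with \<phi> on A and on A^c. Its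
  density matrix on A \<union> \<Lambda> is the product of the commuting marginals (commuting because \<phi> is even),
  so the conditional entropy of \<omega> is exactly S_A(\<phi>), and comparing free energies leaves only the
  surface energies. Monotonicity in B is monotonicity of an infimum, once that infimum is known to
  be finite: averaging the even density matrix \<rho> of A \<union> \<Lambda> over conjugation by the Majorana monomials
  of A gives \<rho> \<le> 2^|A| \<rho>_\<Lambda>, whence S_(A \<union> \<Lambda>) - S_\<Lambda> \<ge> - |A| ln 2. The last inequality is
  |\<psi>(x)| \<le> \<parallel>x\<parallel> for states.

  Eigenvalue multiplicities with respect to the matrix trace are counted without choosing a matrix
  representation: a self-adjoint h in A(I) is resolved into projections of the form w w^* with
  w in A(I) e, where e is the projection onto the joint eigenspace of the site parities. Each of
  them has matrix trace 1, since e A(I) e consists of multiples of e.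
\<close>

section \<open>The sign cocycle\<close>

text \<open>Evenness has two effects. An even density matrix commutes with everything on a disjoint
  region, which is what makes the product of the marginals positive; and averaging over the
  monomials of A removes precisely the monomials that meet A only on even elements, since for odd
  ones the commutation signs are reversed. The lower bound cannot be skipped: a real infimum over a
  set unbounded below has no specified value. Its factor 2^|A| is 4^|A|, the number of monomials on
  A, times the 2^(-|A|) by which normalisations on A \<union> \<Lambda> and \<Lambda> differ. The
  step from \<rho> \<le> 2^|A| \<rho>_\<Lambda> to entropies would usually rest on operator
  monotonicity of the logarithm; here it is reduced to ln u \<le> u - 1 at ratios of eigenvalues,
  weighted by the overlaps of their projections, and the operator inequality enters only through
  expectations of the inverse of \<rho>_\<Lambda> on its support. As spectra are given by a definite
  description through moments, every entropy is computed by comparing power sums.\<close>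

lemma symdiff_simps [simp]:
  "symdiff S {} = S" "symdiff {} S = S" "symdiff S S = {}" "symdiff S (symdiff S T) = T"
  by (auto simp: symdiff_def)

lemma symdiff_commute: "symdiff S T = symdiff T S"
  by (auto simp: symdiff_def)

lemma finite_symdiff [simp]: "finite S \<Longrightarrow> finite T \<Longrightarrow> finite (symdiff S T)"
  by (auto simp: symdiff_def)

lemma symdiff_subset: "S \<subseteq> W \<Longrightarrow> T \<subseteq> W \<Longrightarrow> symdiff S T \<subseteq> W"
  by (auto simp: symdiff_def)

lemma symdiff_eq_empty_iff: "symdiff S T = {} \<longleftrightarrow> S = T"
  by (auto simp: symdiff_def)

text \<open>The factors over the intersection occur twice on the right and cancel, as each squares
  to 1.\<close>

lemma prod_symdiff:
  fixes f :: "'a \<Rightarrow> 'b::comm_monoid_mult"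
  assumes "finite S" "finite T" "\<And>x. f x * f x = 1"
  shows "prod f (symdiff S T) = prod f S * prod f T"
proof -
  have S: "prod f S = prod f (S - T) * prod f (S \<inter> T)"
    using assms(1) by (metis Diff_Diff_Int Diff_subset prod.subset_diff mult.commute)
  have T: "prod f T = prod f (T - S) * prod f (S \<inter> T)"
    using assms(2) by (metis Diff_Diff_Int Diff_subset prod.subset_diff mult.commute Int_commute)
  have I: "prod f (S \<inter> T) * prod f (S \<inter> T) = 1"
    by (simp add: prod.distrib[symmetric] assms(3))
  have "prod f (symdiff S T) = prod f (S - T) * prod f (T - S)"
    unfolding symdiff_def using assms by (intro prod.union_disjoint) auto
  also have "\<dots> = prod f (S - T) * prod f (T - S) * (prod f (S \<inter> T) * prod f (S \<inter> T))"
    by (simp add: I)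
  also have "\<dots> = prod f S * prod f T"
    unfolding S T by (simp add: mult_ac)
  finally show ?thesis .
qed

lemma even_card_symdiff:
  assumes "finite S" "finite T"
  shows "even (card (symdiff S T)) \<longleftrightarrow> (even (card S) \<longleftrightarrow> even (card T))"
proof -
  have "(-1::int) ^ card (symdiff S T) = (-1) ^ card S * (-1) ^ card T"
    using prod_symdiff[OF assms, of "\<lambda>_. -1::int"] by simp
  then show ?thesis
    by (cases "even (card (symdiff S T))"; cases "even (card S)"; cases "even (card T)") auto
qed

definition pair_sgn :: "'a::countable \<Rightarrow> 'a \<Rightarrow> complex" where
  "pair_sgn s t = (if to_nat t < to_nat s then - 1 else 1)"

text \<open>As a product of pairwise signs, \<open>csgn\<close> is multiplicative in each argument
  under \<open>symdiff\<close>; this is the cocycle property behind associativity.\<close>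

lemma csgn_prod:
  assumes "finite S" "finite T"
  shows "csgn S T = (\<Prod>s\<in>S. \<Prod>t\<in>T. pair_sgn s t)"
proof -
  have "(\<Prod>s\<in>S. \<Prod>t\<in>T. pair_sgn s t) =
      (\<Prod>p\<in>S\<times>T. if to_nat (snd p) < to_nat (fst p) then - 1 else 1)"
    by (simp add: prod.cartesian_product pair_sgn_def case_prod_unfold)
  also have "\<dots> = (\<Prod>p\<in>{p\<in>S\<times>T. to_nat (snd p) < to_nat (fst p)}. - 1)"
    using assms by (intro prod.inter_filter[symmetric]) auto
  also have "\<dots> = (- 1) ^ card {p\<in>S\<times>T. to_nat (snd p) < to_nat (fst p)}"
    by simp
  also have "{p\<in>S\<times>T. to_nat (snd p) < to_nat (fst p)} =
      {(s, t). s \<in> S \<and> t \<in> T \<and> to_nat t < to_nat s}"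
    by auto
  finally show ?thesis by (simp add: csgn_def)
qed

lemma csgn_empty [simp]: "csgn {} T = 1" "csgn S {} = 1"
  by (simp_all add: csgn_def)

lemma csgn_cases: "csgn S T = 1 \<or> csgn S T = -1"
  unfolding csgn_def using neg_one_even_power neg_one_odd_power by blast

lemma csgn_square [simp]: "csgn S T * csgn S T = 1" "csgn S T * (csgn S T * x) = x"
  using csgn_cases[of S T] by auto

lemma csgn_nonzero [simp]: "csgn S T \<noteq> 0"
  using csgn_cases[of S T] by auto

lemma cnj_csgn [simp]: "cnj (csgn S T) = csgn S T"
  using csgn_cases[of S T] by auto

lemma csgn_symdiff_left:
  assumes "finite S" "finite T" "finite U"
  shows "csgn (symdiff S T) U = csgn S U * csgn T U"
proof -
  have "(\<Prod>t\<in>U. pair_sgn s t) * (\<Prod>t\<in>U. pair_sgn s t) = 1" for s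
    unfolding prod.distrib[symmetric] by (rule prod.neutral) (simp add: pair_sgn_def)
  with assms show ?thesis by (simp add: csgn_prod prod_symdiff)
qed

lemma csgn_symdiff_right:
  assumes "finite S" "finite T" "finite U"
  shows "csgn U (symdiff S T) = csgn U S * csgn U T"
  using assms
  by (simp add: csgn_prod prod_symdiff prod.distrib[symmetric] pair_sgn_def)

text \<open>Swapping pairs matches the two halves of S x S off the diagonal, so the exponent is
  k(k-1)/2. The sign in \<open>cadj\<close> is thereby \<open>csgn S S\<close>, and the star falls
  under the same multiplicative calculus.\<close>

lemma csgn_self:
  assumes "finite S"
  shows "csgn S S = (-1) ^ (card S * (card S - 1) div 2)"
proof -
  let ?L = "{(s, t). s \<in> S \<and> t \<in> S \<and> to_nat t < to_nat s}"
  let ?G = "{(s, t). s \<in> S \<and> t \<in> S \<and> to_nat s < to_nat t}"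
  let ?D = "(\<lambda>s. (s, s)) ` S"
  have fin: "finite ?L" "finite ?G" "finite ?D"
    using assms by (auto intro: finite_subset[of _ "S \<times> S"])
  have G: "card ?G = card ?L"
    by (intro bij_betw_same_card[of prod.swap] bij_betwI[where g = prod.swap]) auto
  have D: "card ?D = card S"
    by (intro card_image) (auto simp: inj_on_def)
  have split: "S \<times> S = (?L \<union> ?G) \<union> ?D"
    using to_nat_split by (auto simp: image_iff)
  have "card S * card S = card (S \<times> S)" by (simp add: card_cartesian_product)
  also have "\<dots> = card (?L \<union> ?G) + card ?D"
    unfolding split by (rule card_Un_disjoint) (use fin in auto)
  also have "card (?L \<union> ?G) = card ?L + card ?G"
    by (rule card_Un_disjoint) (use fin in auto)
  finally have "card S * card S = 2 * card ?L + card S"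
    using G D by simp
  then have "card S * (card S - 1) = 2 * card ?L"
    by (simp add: algebra_simps)
  then show ?thesis by (simp add: csgn_def)
qed

text \<open>The sign by which two monomials commute. A pair s, t contributes -1 unless s = t, so the
  enumeration of the indices drops out.\<close>

definition comm_sgn :: "('g::countable \<times> bool) set \<Rightarrow> ('g \<times> bool) set \<Rightarrow> complex" where
  "comm_sgn S T = csgn S T * csgn T S"

lemma comm_sgn_prod:
  assumes "finite S" "finite T"
  shows "comm_sgn S T = (\<Prod>s\<in>S. \<Prod>t\<in>T. if s = t then 1 else - 1)"
proof -
  have "csgn T S = (\<Prod>s\<in>S. \<Prod>t\<in>T. pair_sgn t s)"
    using assms by (simp add: csgn_prod prod.swap[of _ S T])
  moreover have "pair_sgn s t * pair_sgn t s = (if s = t then 1 else - 1)"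
    for s t :: "'a \<times> bool"
    using to_nat_split[of s t] by (auto simp: pair_sgn_def) 
  ultimately show ?thesis
    using assms by (simp add: comm_sgn_def csgn_prod prod.distrib[symmetric])
qed

lemma comm_sgn_disjoint:
  assumes "finite S" "finite T" "S \<inter> T = {}"
  shows "comm_sgn S T = (-1) ^ (card S * card T)"
proof -
  have "(\<Prod>s\<in>S. \<Prod>t\<in>T. if s = t then 1 else - 1 :: complex) = (\<Prod>s\<in>S. \<Prod>t\<in>T. - 1)"
    using assms(3) by (intro prod.cong refl) auto
  then show ?thesis
    using assms by (simp add: comm_sgn_prod power_mult mult.commute[of "card S"])
qed

text \<open>Pulling -1 out of all |T| factors costs nothing when |T| is even; what remains is -1 for
  each s that lies in T.\<close>

lemma comm_sgn_even:
  assumes "finite S" "finite T" "even (card T)"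
  shows "comm_sgn S T = (\<Prod>s\<in>S. if s \<in> T then - 1 else 1)"
proof -
  have "(\<Prod>t\<in>T. if s = t then 1 else - 1 :: complex) = (if s \<in> T then - 1 else 1)" for s
  proof -
    have "(\<Prod>t\<in>T. if s = t then 1 else - 1 :: complex)
        = (\<Prod>t\<in>T. (-1) * (if s = t then -1 else 1))"
      by (intro prod.cong refl) auto
    also have "\<dots> = (-1) ^ card T * (\<Prod>t\<in>T. if s = t then -1 else 1)"
      by (simp only: prod.distrib prod_constant)
    also have "\<dots> = (if s \<in> T then - 1 else 1)"
      using assms by simp
    finally show ?thesis .
  qed
  then show ?thesis using assms by (simp add: comm_sgn_prod)
qed

text \<open>For even T, \<open>comm_sgn\<close> in its first argument is a character of the group of
  subsets of W under \<open>symdiff\<close>, nontrivial as soon as W meets T; this is its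
  orthogonality to the trivial character.\<close>

lemma sum_comm_sgn_Pow:
  assumes "finite W" "finite T" "even (card T)"
  shows "(\<Sum>S\<in>Pow W. comm_sgn S T) = (if W \<inter> T = {} then 2 ^ card W else 0)"
proof -
  have "(\<Sum>S\<in>Pow W. comm_sgn S T) = (\<Sum>S\<in>Pow W. \<Prod>s\<in>S. if s \<in> T then - 1 else 1)"
    using assms by (intro sum.cong refl comm_sgn_even) (auto intro: finite_subset)
  also have "\<dots> = (\<Prod>s\<in>W. (if s \<in> T then - 1 else 1) + 1)"
    using assms by (simp add: prod_add)
  also have "\<dots> = (if W \<inter> T = {} then 2 ^ card W else 0)"
  proof (cases "W \<inter> T = {}")
    case True
    then have "(\<Prod>s\<in>W. (if s \<in> T then - 1 else 1) + 1 :: complex) = (\<Prod>s\<in>W. 2)"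
      by (intro prod.cong) auto
    then show ?thesis using True by simp
  next
    case False
    then show ?thesis using assms by (auto simp: prod_zero_iff)
  qed
  finally show ?thesis .
qed

section \<open>The local algebra\<close>

lemma supp_in_mono: "supp_in I f \<Longrightarrow> I \<subseteq> J \<Longrightarrow> supp_in J f"
  unfolding supp_in_def by blast

lemma supp_in_cmul: "supp_in I f \<Longrightarrow> supp_in I g \<Longrightarrow> supp_in I (cmul f g)"
  unfolding supp_in_def
proof (intro allI impI)
  fix U
  assume f: "\<forall>S. f S \<noteq> 0 \<longrightarrow> S \<subseteq> I \<times> UNIV" and g: "\<forall>S. g S \<noteq> 0 \<longrightarrow> S \<subseteq> I \<times> UNIV"
    and "cmul f g U \<noteq> 0"
  then obtain S where "f S \<noteq> 0" "g (symdiff S U) \<noteq> 0"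
    unfolding cmul_def by (metis (no_types, lifting) mult_zero_left mult_zero_right sum.neutral)
  then have "S \<subseteq> I \<times> UNIV" "symdiff S U \<subseteq> I \<times> UNIV"
    using f g by blast+
  then show "U \<subseteq> I \<times> UNIV"
    using symdiff_subset[of S "I \<times> UNIV" "symdiff S U"] by simp
qed

lemma supp_in_cadd: "supp_in I f \<Longrightarrow> supp_in I g \<Longrightarrow> supp_in I (cadd f g)"
  unfolding supp_in_def cadd_def by (metis add_0)

lemma loc_common:
  assumes "loc f" "loc g"
  obtains L where "finite L" "supp_in L f" "supp_in L g"
  using assms unfolding loc_def by (metis finite_UnI supp_in_mono sup_ge1 sup_ge2)

lemma loc_cmul: "loc f \<Longrightarrow> loc g \<Longrightarrow> loc (cmul f g)"
  by (metis loc_common loc_def supp_in_cmul)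

lemma loc_cadd: "loc f \<Longrightarrow> loc g \<Longrightarrow> loc (cadd f g)"
  by (metis loc_common loc_def supp_in_cadd)

lemma loc_finite:
  assumes "loc f" "f S \<noteq> 0"
  shows "finite S"
proof -
  obtain L where "finite L" "S \<subseteq> L \<times> (UNIV :: bool set)"
    using assms unfolding loc_def supp_in_def by blast
  then show ?thesis by (meson finite_SigmaI finite finite_subset)
qed

text \<open>A fixed finite index set instead of the support of f lets sums for different elements be
  added and interchanged.\<close>

lemma cmul_Pow:
  assumes "finite W" "\<And>S. f S \<noteq> 0 \<Longrightarrow> S \<subseteq> W"
  shows "cmul f g U = (\<Sum>S\<in>Pow W. f S * g (symdiff S U) * csgn S (symdiff S U))"
  unfolding cmul_def using assms by (intro sum.mono_neutral_left) auto

lemma loc_Pow: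
  assumes "loc f"
  obtains W where "finite W" "\<And>S. f S \<noteq> 0 \<Longrightarrow> S \<subseteq> W"
proof -
  obtain L where "finite L" "supp_in L f" using assms unfolding loc_def by blast
  then show ?thesis by (intro that[of "L \<times> UNIV"]) (auto simp: supp_in_def)
qed

lemma cmul_assoc:
  assumes "loc f" "loc g" "loc h"
  shows "cmul (cmul f g) h = cmul f (cmul g h)"
proof
  fix U
  obtain L where L: "finite L" "supp_in L f" "supp_in L g"
    using loc_common assms(1,2) by blast
  define W :: "('a \<times> bool) set" where "W = L \<times> UNIV"
  have W: "finite W" using L by (simp add: W_def)
  have f: "f S \<noteq> 0 \<Longrightarrow> S \<subseteq> W" and g: "g S \<noteq> 0 \<Longrightarrow> S \<subseteq> W"
    and fg: "cmul f g S \<noteq> 0 \<Longrightarrow> S \<subseteq> W" for S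
    using L supp_in_cmul[OF L(2,3)] by (auto simp: W_def supp_in_def)
  have "cmul (cmul f g) h U =
      (\<Sum>T\<in>Pow W. \<Sum>S\<in>Pow W. f S * g (symdiff S T) * csgn S (symdiff S T) * h (symdiff T U) * csgn T (symdiff T U))"
    by (subst cmul_Pow[OF W fg], assumption) (simp add: cmul_Pow[OF W f] sum_distrib_right)
  also have "\<dots> = (\<Sum>S\<in>Pow W. \<Sum>T\<in>Pow W. f S * g (symdiff S T) * csgn S (symdiff S T) * h (symdiff T U) * csgn T (symdiff T U))"
    by (rule sum.swap)
  also have "\<dots> = (\<Sum>S\<in>Pow W. \<Sum>R\<in>Pow W. f S * (g R * h (symdiff R (symdiff S U)) * csgn R (symdiff R (symdiff S U))) * csgn S (symdiff S U))"
  proof (rule sum.cong[OF refl])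
    fix S assume S: "S \<in> Pow W"
    have fS: "finite S" using S W finite_subset by auto
    show "(\<Sum>T\<in>Pow W. f S * g (symdiff S T) * csgn S (symdiff S T) * h (symdiff T U) * csgn T (symdiff T U))
      = (\<Sum>R\<in>Pow W. f S * (g R * h (symdiff R (symdiff S U)) * csgn R (symdiff R (symdiff S U))) * csgn S (symdiff S U))"
    proof (rule sum.reindex_bij_witness[where i = "symdiff S" and j = "symdiff S"])
      fix T assume T: "T \<in> Pow W"
      show "symdiff S T \<in> Pow W" using S T symdiff_subset[of S W T] by auto
      have fT: "finite T" using T W finite_subset by auto
      have *: "symdiff (symdiff S T) (symdiff S U) = symdiff T U"
        by (auto simp: symdiff_def)
      show "f S * (g (symdiff S T) * h (symdiff (symdiff S T) (symdiff S U)) *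
          csgn (symdiff S T) (symdiff (symdiff S T) (symdiff S U))) * csgn S (symdiff S U) =
          f S * g (symdiff S T) * csgn S (symdiff S T) * h (symdiff T U) * csgn T (symdiff T U)"
      \<comment> \<open>U is an arbitrary set, while the sign rules need finite ones; a nonzero
        coefficient of the local h supplies the finiteness.\<close>
      proof (cases "h (symdiff T U) = 0")
        case False
        then have fTU: "finite (symdiff T U)" using loc_finite assms(3) by blast
        have "csgn S (symdiff S U) = csgn S (symdiff (symdiff S T) (symdiff T U))"
          by (rule arg_cong[of _ _ "csgn S"]) (auto simp: symdiff_def)
        also have "\<dots> = csgn S (symdiff S T) * csgn S (symdiff T U)"
          using fS fT fTU by (intro csgn_symdiff_right) auto
        finally show ?thesis
          unfolding * using fS fT fTU by (simp add: csgn_symdiff_left)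
      qed (simp add: *)
    qed (use S in \<open>simp_all add: symdiff_subset\<close>)
  qed
  also have "\<dots> = cmul f (cmul g h) U"
    by (subst cmul_Pow[OF W f], assumption) (simp add: cmul_Pow[OF W g] sum_distrib_left sum_distrib_right)
  finally show "cmul (cmul f g) h U = cmul f (cmul g h) U" .
qed

lemma loc_cone: "loc cone"
  unfolding loc_def supp_in_def cone_def by (intro exI[of _ "{}"]) auto

lemma cmul_cone_left: "cmul cone f = f"
proof
  fix U show "cmul cone f U = f U"
    by (subst cmul_Pow[where W = "{}"]) (auto simp: cone_def split: if_splits)
qed

lemma cmul_cone_right:
  assumes "loc f" shows "cmul f cone = f"
proof
  fix U
  obtain W where W: "finite W" "\<And>S. f S \<noteq> 0 \<Longrightarrow> S \<subseteq> W"
    using loc_Pow assms by blast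
  have "cmul f cone U = (\<Sum>S\<in>Pow W. if S = U then f U else 0)"
    by (subst cmul_Pow[OF W]) (auto simp: cone_def symdiff_eq_empty_iff intro!: sum.cong)
  also have "\<dots> = f U" using W by (auto simp: sum.delta)
  finally show "cmul f cone U = f U" .
qed

text \<open>As a type, the local elements form a genuine ring; gm S below is the monomial gamma_S.\<close>

typedef 'g la = "{f :: 'g car. loc f}"
  morphisms coef mk_la
  using loc_cone by blast

setup_lifting type_definition_la

lemma loc_coef [simp]: "loc (coef x)"
  using coef by blast

instantiation la :: (type) ab_group_add
begin
lift_definition zero_la :: "'a la" is "\<lambda>_. 0"
  by (auto simp: loc_def supp_in_def)
lift_definition plus_la :: "'a la \<Rightarrow> 'a la \<Rightarrow> 'a la" is cadd by (rule loc_cadd)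
lift_definition uminus_la :: "'a la \<Rightarrow> 'a la" is "\<lambda>f S. - f S"
  by (auto simp: loc_def supp_in_def)
lift_definition minus_la :: "'a la \<Rightarrow> 'a la \<Rightarrow> 'a la" is cdiff
proof -
  fix f g :: "'a car" assume "loc f" "loc g"
  then obtain L where "finite L" "supp_in L f" "supp_in L g" by (rule loc_common)
  then have "supp_in L (cdiff f g)"
    unfolding supp_in_def cdiff_def by (metis diff_0_right)
  then show "loc (cdiff f g)" using \<open>finite L\<close> loc_def by blast
qed
instance
  by intro_classes (transfer; auto simp: cadd_def cdiff_def fun_eq_iff)+
end

instantiation la :: (countable) ring_1
begin
lift_definition one_la :: "'a la" is cone by (rule loc_cone)
lift_definition times_la :: "'a la \<Rightarrow> 'a la \<Rightarrow> 'a la" is cmul by (rule loc_cmul)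
instance
proof
  fix a b c :: "'a la"
  show "a * b * c = a * (b * c)" by transfer (rule cmul_assoc)
  show "1 * a = a" by transfer (rule cmul_cone_left)
  show "a * 1 = a" by transfer (rule cmul_cone_right)
  show "(a + b) * c = a * c + b * c"
  proof (transfer, rule ext)
    fix a b c :: "'a car" and U assume "loc a" "loc b" "loc c"
    then obtain L where L: "finite L" "supp_in L a" "supp_in L b" using loc_common by blast
    then have *: "finite (L \<times> (UNIV::bool set))" "\<And>S. a S \<noteq> 0 \<Longrightarrow> S \<subseteq> L \<times> UNIV"
      "\<And>S. b S \<noteq> 0 \<Longrightarrow> S \<subseteq> L \<times> UNIV" "\<And>S. cadd a b S \<noteq> 0 \<Longrightarrow> S \<subseteq> L \<times> UNIV"
      using supp_in_cadd[OF L(2,3)] by (auto simp: supp_in_def)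
    show "cmul (cadd a b) c U = cadd (cmul a c) (cmul b c) U"
      using cmul_Pow[OF *(1,4)] cmul_Pow[OF *(1,2)] cmul_Pow[OF *(1,3)]
      by (simp add: cadd_def algebra_simps sum.distrib)
  qed
  show "a * (b + c) = a * b + a * c"
    by transfer (simp add: cmul_def cadd_def fun_eq_iff algebra_simps sum.distrib)
  show "(0::'a la) \<noteq> 1"
    by transfer (auto simp: cone_def fun_eq_iff)
qed
end

lift_definition sc :: "complex \<Rightarrow> 'g la \<Rightarrow> 'g la" is cscale
  by (auto simp: loc_def supp_in_def cscale_def)

lift_definition star :: "'g la \<Rightarrow> 'g la" is cadj
  by (auto simp: loc_def supp_in_def cadj_def)

text \<open>An infinite S is sent to 0, which keeps the result local.\<close>

lift_definition gm :: "('g \<times> bool) set \<Rightarrow> 'g la" is "\<lambda>S T. if finite S \<and> T = S then 1 else 0"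
  subgoal for S
    unfolding loc_def supp_in_def by (intro exI[of _ "if finite S then fst ` S else {}"]) force
  done

definition tr :: "'g la \<Rightarrow> complex" where "tr x = coef x {}"

lemma coef_simps [simp]:
  "coef 0 S = 0" "coef (x + y) S = coef x S + coef y S" "coef (x - y) S = coef x S - coef y S"
  "coef (- x) S = - coef x S" "coef (sc c x) S = c * coef x S"
  "coef (gm S) T = (if finite S \<and> T = S then 1 else 0)"
  by (simp_all add: zero_la.rep_eq plus_la.rep_eq minus_la.rep_eq uminus_la.rep_eq sc.rep_eq
      gm.rep_eq cadd_def cdiff_def cscale_def)

lemma coef_one [simp]: "coef 1 S = (if S = {} then 1 else 0)"
  by (simp add: one_la.rep_eq cone_def)

lemma coef_sum [simp]: "coef (sum f F) S = (\<Sum>i\<in>F. coef (f i) S)"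
  by (induction F rule: infinite_finite_induct) auto

lemma la_eqI: "(\<And>S. finite S \<Longrightarrow> coef x S = coef y S) \<Longrightarrow> x = y"
  by (metis coef_inject ext loc_coef loc_finite)

lemma coef_infinite: "infinite S \<Longrightarrow> coef x S = 0"
  using loc_coef loc_finite by blast

lemma sc_simps [simp]:
  "sc a (sc b x) = sc (a * b) x" "sc 1 x = x" "sc 0 x = 0" "sc a 0 = 0"
  "sc (- a) x = - sc a x" "sc a (- x) = - sc a x"
  by (auto intro!: la_eqI)

lemma sc_add: "sc a (x + y) = sc a x + sc a y"
  and sc_add_left: "sc (a + b) x = sc a x + sc b x"
  and sc_diff: "sc a (x - y) = sc a x - sc a y"
  and sc_diff_left: "sc (a - b) x = sc a x - sc b x"
  by (auto intro!: la_eqI simp: algebra_simps)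

lemma sc_sum: "sc a (sum f F) = (\<Sum>i\<in>F. sc a (f i))"
  by (auto intro!: la_eqI simp: sum_distrib_left)

lemma sc_eq_0_iff [simp]: "sc a x = 0 \<longleftrightarrow> a = 0 \<or> x = 0"
proof
  assume "sc a x = 0"
  moreover have "x = sc (inverse a) (sc a x)" if "a \<noteq> 0" using that by simp
  ultimately show "a = 0 \<or> x = 0" by (metis sc_simps(4))
qed auto

lemma sc_left [simp]: "sc a x * y = sc a (x * y)"
\<comment> \<open>The product sums over the support of its left factor, which scaling leaves
  unchanged only for a \<noteq> 0.\<close>
proof (cases "a = 0")
  case False
  then show ?thesis by transfer (auto simp: cmul_def cscale_def fun_eq_iff sum_distrib_left mult_ac)
qed simp

lemma sc_right [simp]: "x * sc a y = sc a (x * y)"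
  by transfer (auto simp: cmul_def cscale_def fun_eq_iff sum_distrib_left mult_ac)

lemma gm_empty [simp]: "gm {} = 1"
  by (rule la_eqI) auto

lemma gm_expand:
  assumes "finite W" "\<And>S. coef x S \<noteq> 0 \<Longrightarrow> S \<in> W"
  shows "x = (\<Sum>S\<in>W. sc (coef x S) (gm S))"
proof (rule la_eqI)
  fix T :: "('a \<times> bool) set" assume "finite T"
  have "coef (\<Sum>S\<in>W. sc (coef x S) (gm S)) T = (\<Sum>S\<in>W. if S = T then coef x T else 0)"
    using \<open>finite T\<close> by (auto intro!: sum.cong)
  also have "\<dots> = coef x T" using assms by (auto simp: sum.delta)
  finally show "coef x T = coef (\<Sum>S\<in>W. sc (coef x S) (gm S)) T" by simp
qed

lemma gm_mult:
  assumes "finite S" "finite T"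
  shows "gm S * gm T = sc (csgn S T) (gm (symdiff S T))"
proof (rule la_eqI)
  fix U :: "('a \<times> bool) set" assume "finite U"
  have "coef (gm S * gm T) U = (\<Sum>R\<in>Pow S. coef (gm S) R * coef (gm T) (symdiff R U) * csgn R (symdiff R U))"
    unfolding times_la.rep_eq using assms by (subst cmul_Pow[of S]) (auto split: if_splits)
  also have "\<dots> = (\<Sum>R\<in>Pow S. if R = S then (if symdiff S U = T then csgn S T else 0) else 0)"
    using assms by (intro sum.cong) auto
  also have "\<dots> = (if symdiff S U = T then csgn S T else 0)"
    using assms by (simp add: sum.delta)
  also have "\<dots> = coef (sc (csgn S T) (gm (symdiff S T))) U"
    using assms by auto
  finally show "coef (gm S * gm T) U = coef (sc (csgn S T) (gm (symdiff S T))) U" .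
qed

lemma gm_commute:
  assumes "finite S" "finite T"
  shows "gm S * gm T = sc (comm_sgn S T) (gm T * gm S)"
  using assms by (simp add: gm_mult comm_sgn_def symdiff_commute[of T S] mult.assoc)

lemma coef_star: "coef (star x) S = cnj (coef x S) * csgn S S"
  by (cases "finite S") (simp_all add: star.rep_eq cadj_def csgn_self coef_infinite)

lemma star_simps [simp]:
  "star (star x) = x" "star (x + y) = star x + star y" "star (x - y) = star x - star y"
  "star (- x) = - star x" "star (sc a x) = sc (cnj a) (star x)" "star (0 :: 'g la) = 0" "star (1 :: 'g la) = 1"
  for x y :: "'g::countable la"
  by (auto intro!: la_eqI simp: coef_star algebra_simps)

lemma star_sum [simp]: "star (sum f F) = (\<Sum>i\<in>F. star (f i :: 'g::countable la))"
  by (induction F rule: infinite_finite_induct) auto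

lemma star_gm: "star (gm S) = sc (csgn S S) (gm S)" for S :: "('g::countable \<times> bool) set"
  by (rule la_eqI) (auto simp: coef_star)

lemma gm_star_gm [simp]: "finite S \<Longrightarrow> star (gm S) * gm S = 1" "finite S \<Longrightarrow> gm S * star (gm S) = 1"
  by (simp_all add: star_gm gm_mult)

lemma coef_support_finite: "finite {S. coef x S \<noteq> 0}"
proof -
  obtain L where "finite L" "supp_in L (coef x)" using loc_coef[of x] unfolding loc_def by blast
  then have "{S. coef x S \<noteq> 0} \<subseteq> Pow (L \<times> UNIV)" by (auto simp: supp_in_def)
  then show ?thesis using \<open>finite L\<close> by (meson finite_Pow_iff finite_SigmaI finite finite_subset)
qed

text \<open>Linear induction that remembers that each monomial occurs in x, so that its region and
  its parity are inherited from x.\<close>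

lemma la_support_induct [case_names zero add sc gm]:
  assumes "P 0" "\<And>x y. P x \<Longrightarrow> P y \<Longrightarrow> P (x + y)" "\<And>a x. P x \<Longrightarrow> P (sc a x)"
    and "\<And>S. finite S \<Longrightarrow> coef x S \<noteq> 0 \<Longrightarrow> P (gm S)"
  shows "P x"
proof -
  have "P (\<Sum>S\<in>W. sc (coef x S) (gm S))" if "finite W" "W \<subseteq> {S. coef x S \<noteq> 0}" for W
    using that
  proof (induction W rule: finite_induct)
    case (insert S W)
    then have "finite S" using coef_infinite by blast
    with insert assms show ?case by auto
  qed (simp add: assms)
  then have "P (\<Sum>S | coef x S \<noteq> 0. sc (coef x S) (gm S))"
    using coef_support_finite by blast
  moreover have "(\<Sum>S | coef x S \<noteq> 0. sc (coef x S) (gm S)) = x"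
    by (rule gm_expand[symmetric]) (simp_all add: coef_support_finite)
  ultimately show ?thesis by (rule back_subst)
qed

lemma la_induct [case_names add sc gm]:
  assumes "\<And>x y. P x \<Longrightarrow> P y \<Longrightarrow> P (x + y)" "\<And>a x. P x \<Longrightarrow> P (sc a x)" "\<And>S. finite S \<Longrightarrow> P (gm S)"
  shows "P x"
proof (rule la_support_induct)
  show "P 0" using assms(2)[of "gm {}" 0] assms(3)[of "{}"] by simp
qed (use assms in auto)

lemma star_mult [simp]: "star (x * y) = star y * star x"
proof (induction x rule: la_induct)
  case (gm S)
  show ?case
  proof (induction y rule: la_induct)
    case (gm T)
    with \<open>finite S\<close> show ?case
      by (simp add: star_gm gm_mult csgn_symdiff_left csgn_symdiff_right symdiff_commute[of T S] mult_ac)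
  qed (simp_all add: algebra_simps)
qed (simp_all add: algebra_simps)

section \<open>The normalised trace and its inner product\<close>

lemma tr_simps [simp]:
  "tr 0 = 0" "tr (x + y) = tr x + tr y" "tr (x - y) = tr x - tr y" "tr (- x) = - tr x"
  "tr (sc a x) = a * tr x" "tr (sum f F) = (\<Sum>i\<in>F. tr (f i))"
  by (simp_all add: tr_def)

lemma tr_one [simp]: "tr 1 = 1"
  by (simp add: tr_def)

lemma tr_star: "tr (star x) = cnj (tr x)" for x :: "'g::countable la"
  by (simp add: tr_def coef_star)

lemma tr_gm: "finite S \<Longrightarrow> tr (gm S) = (if S = {} then 1 else 0)"
  by (auto simp: tr_def)

lemma tr_gm_mult: "finite S \<Longrightarrow> finite T \<Longrightarrow> tr (gm S * gm T) = (if S = T then csgn S S else 0)"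
  by (simp add: gm_mult tr_gm symdiff_eq_empty_iff)

lemma tr_commute: "tr (x * y) = tr (y * x)"
proof (induction x rule: la_induct)
  case (gm S)
  show ?case
  proof (induction y rule: la_induct)
    case (gm T)
    with \<open>finite S\<close> show ?case by (simp add: tr_gm_mult)
  qed (simp_all add: algebra_simps)
qed (simp_all add: algebra_simps)

lemma tr_mult_gm: "finite S \<Longrightarrow> tr (x * gm S) = csgn S S * coef x S"
  by (induction x rule: la_induct) (auto simp: tr_gm_mult algebra_simps)

text \<open>Parseval's identity: the monomials are orthonormal for tr(star x * y).\<close>

lemma tr_star_mult:
  assumes "finite W" "\<And>S. coef x S \<noteq> 0 \<Longrightarrow> S \<in> W" "\<And>S. S \<in> W \<Longrightarrow> finite S"
  shows "tr (star x * x) = of_real (\<Sum>S\<in>W. (cmod (coef x S))\<^sup>2)"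
proof -
  have "tr (star x * x) = tr (star x * (\<Sum>S\<in>W. sc (coef x S) (gm S)))"
    using gm_expand[OF assms(1,2)] by simp
  also have "\<dots> = (\<Sum>S\<in>W. coef x S * cnj (coef x S))"
    using assms(3) by (auto simp: sum_distrib_left tr_mult_gm coef_star intro!: sum.cong)
  finally show ?thesis by (simp add: complex_mult_cnj cmod_power2)
qed

text \<open>The squared Hilbert-Schmidt norm for the normalised trace, that is, the squared length
  in the GNS space of the tracial state.\<close>

definition hs :: "'g::countable la \<Rightarrow> real" where
  "hs x = Re (tr (star x * x))"

lemma tr_star_hs: "tr (star x * x) = of_real (hs x)"
  using tr_star_mult[OF coef_support_finite[of x], of x] coef_infinite unfolding hs_def by force

lemma hs_nonneg [simp]: "hs x \<ge> 0"
  using tr_star_mult[OF coef_support_finite[of x], of x] coef_infinite unfolding hs_def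
  by (force intro: sum_nonneg)

lemma hs_eq_0_iff [simp]: "hs x = 0 \<longleftrightarrow> x = 0"
proof
  assume "hs x = 0"
  then have "(\<Sum>S\<in>{S. coef x S \<noteq> 0}. (cmod (coef x S))\<^sup>2) = 0"
    using tr_star_mult[OF coef_support_finite[of x], of x] coef_infinite unfolding hs_def by force
  then have "{S. coef x S \<noteq> 0} = {}"
    by (subst (asm) sum_nonneg_eq_0_iff) (auto simp: coef_support_finite)
  then show "x = 0" by (intro la_eqI) auto
qed (simp add: hs_def)

section \<open>Regions, parity and averaging\<close>

definition on_reg :: "'g set \<Rightarrow> 'g la \<Rightarrow> bool" where
  "on_reg I x \<longleftrightarrow> supp_in I (coef x)"

lemma on_reg_iff: "on_reg I x \<longleftrightarrow> (\<forall>S. coef x S \<noteq> 0 \<longrightarrow> S \<subseteq> I \<times> UNIV)"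
  by (simp add: on_reg_def supp_in_def)

lemma on_reg_mono: "on_reg I x \<Longrightarrow> I \<subseteq> J \<Longrightarrow> on_reg J x"
  unfolding on_reg_def by (rule supp_in_mono)

lemma on_reg_simps [simp]:
  "on_reg I 0" "on_reg I x \<Longrightarrow> on_reg I (- x)" "on_reg I x \<Longrightarrow> on_reg I (sc a x)"
  by (simp_all add: on_reg_iff)

lemma on_reg_add [simp]: "on_reg I x \<Longrightarrow> on_reg I y \<Longrightarrow> on_reg I (x + y)"
  unfolding on_reg_def plus_la.rep_eq by (rule supp_in_cadd)

lemma on_reg_diff [simp]: "on_reg I x \<Longrightarrow> on_reg I y \<Longrightarrow> on_reg I (x - y)"
  using on_reg_add[of I x "- y"] by simp

lemma on_reg_one [simp]: "on_reg I 1"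
  by (simp add: on_reg_iff)

lemma on_reg_mult [simp]: "on_reg I x \<Longrightarrow> on_reg I y \<Longrightarrow> on_reg I (x * y)"
  unfolding on_reg_def times_la.rep_eq by (rule supp_in_cmul)

lemma on_reg_star [simp]: "on_reg I x \<Longrightarrow> on_reg I (star x)" for x :: "'g::countable la"
  by (simp add: on_reg_iff coef_star)

lemma on_reg_sum [simp]: "(\<And>i. i \<in> F \<Longrightarrow> on_reg I (f i)) \<Longrightarrow> on_reg I (sum f F)"
  by (induction F rule: infinite_finite_induct) auto

lemma on_reg_power [simp]: "on_reg I x \<Longrightarrow> on_reg I (x ^ n)"
  by (induction n) auto

lemma on_reg_gm [simp]: "S \<subseteq> I \<times> UNIV \<Longrightarrow> on_reg I (gm S)"
  by (auto simp: on_reg_iff)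

lemma on_reg_exists: "\<exists>I. finite I \<and> on_reg I x"
  using loc_coef[of x] unfolding loc_def on_reg_def .

lemma coef_mult_nonzero:
  assumes "coef (x * y) U \<noteq> 0"
  obtains S where "coef x S \<noteq> 0" "coef y (symdiff S U) \<noteq> 0"
proof -
  have "\<exists>S. coef x S \<noteq> 0 \<and> coef y (symdiff S U) \<noteq> 0"
  proof (rule ccontr)
    assume "\<nexists>S. coef x S \<noteq> 0 \<and> coef y (symdiff S U) \<noteq> 0"
    then have "coef (x * y) U = 0"
      unfolding times_la.rep_eq cmul_def by (intro sum.neutral) auto
    with assms show False by simp
  qed
  then show ?thesis using that by blast
qed

section \<open>Parity, and commutation across disjoint regions\<close>

definition even_la :: "'g la \<Rightarrow> bool" where
  "even_la x \<longleftrightarrow> (\<forall>S. coef x S \<noteq> 0 \<longrightarrow> even (card S))"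

lemma even_la_simps [simp]:
  "even_la x \<Longrightarrow> even_la (sc a x)" "even (card S) \<Longrightarrow> even_la (gm S)"
  by (simp_all add: even_la_def)

lemma even_la_add [simp]: "even_la x \<Longrightarrow> even_la y \<Longrightarrow> even_la (x + y)"
  unfolding even_la_def coef_simps by (metis add_0)

lemma even_la_one [simp]: "even_la 1"
  by (simp add: even_la_def)

lemma even_la_mult [simp]:
  assumes "even_la x" "even_la y"
  shows "even_la (x * y)"
  unfolding even_la_def
proof (intro allI impI)
  fix U assume U: "coef (x * y) U \<noteq> 0"
  then obtain S where S: "coef x S \<noteq> 0" "coef y (symdiff S U) \<noteq> 0"
    by (rule coef_mult_nonzero)
  have "finite S" "finite U" using S U coef_infinite by blast+
  with S assms show "even (card U)"
    unfolding even_la_def using even_card_symdiff[of S U] by blast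
qed

text \<open>Monomials over disjoint index sets commute up to (-1)^(|S| |T|), and |S| is even.
  Applied to density matrices, this is how the evenness of the state is exploited.\<close>

lemma even_commute:
  assumes x: "even_la x" "on_reg I x" and y: "on_reg J y" and IJ: "I \<inter> J = {}"
  shows "x * y = y * x"
proof (induction x rule: la_support_induct)
  case (gm S)
  show ?case
  proof (induction y rule: la_support_induct)
    case (gm T)
    have "S \<subseteq> I \<times> UNIV" "T \<subseteq> J \<times> UNIV" "even (card S)"
      using x y \<open>coef x S \<noteq> 0\<close> \<open>coef y T \<noteq> 0\<close> by (auto simp: on_reg_iff even_la_def)
    moreover from this IJ have "S \<inter> T = {}" by blast
    ultimately show ?case
      using \<open>finite S\<close> \<open>finite T\<close> by (simp add: gm_commute[of S T] comm_sgn_disjoint)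
  qed (simp_all add: algebra_simps)
qed (simp_all add: algebra_simps)

lemma tr_mult_disjoint:
  assumes x: "on_reg I x" and y: "on_reg J y" and IJ: "I \<inter> J = {}"
  shows "tr (x * y) = tr x * tr y"
proof (induction x rule: la_support_induct)
  case (gm S)
  show ?case
  proof (induction y rule: la_support_induct)
    case (gm T)
    have "S \<subseteq> I \<times> UNIV" "T \<subseteq> J \<times> UNIV"
      using x y \<open>coef x S \<noteq> 0\<close> \<open>coef y T \<noteq> 0\<close> by (auto simp: on_reg_iff)
    then have "S = T \<Longrightarrow> S = {}" using IJ by auto
    then show ?case
      using \<open>finite S\<close> \<open>finite T\<close> by (auto simp: tr_gm_mult tr_gm)
  qed (simp_all add: algebra_simps)
qed (simp_all add: algebra_simps)

text \<open>The trace-preserving conditional expectation onto the algebra of I: it drops every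
  monomial that leaves I.\<close>

lift_definition restr :: "'g set \<Rightarrow> 'g la \<Rightarrow> 'g la"
  is "\<lambda>I f S. if S \<subseteq> I \<times> UNIV then f S else 0"
  by (auto simp: loc_def supp_in_def)

lemma coef_restr [simp]: "coef (restr I x) S = (if S \<subseteq> I \<times> UNIV then coef x S else 0)"
  by (simp add: restr.rep_eq)

text \<open>Conjugation by \<open>gm S\<close> multiplies an even monomial by the character
  \<open>comm_sgn S T\<close>, so summing over S keeps only the monomials that avoid A. There are
  2|A| Majorana indices over A, hence 4^|A| conjugations.\<close>

lemma twirl:
  assumes "finite A" "even_la z"
  shows "(\<Sum>S\<in>Pow (A \<times> UNIV). gm S * z * star (gm S)) = sc (4 ^ card A) (restr (- A) z)"
proof (induction z rule: la_support_induct)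
  case zero
  show ?case by (simp add: la_eqI)
next
  case (add x y)
  have "restr (- A) (x + y) = restr (- A) x + restr (- A) y" by (auto intro!: la_eqI)
  with add show ?case by (simp add: algebra_simps sum.distrib sc_add)
next
  case (sc a x)
  have "restr (- A) (sc a x) = sc a (restr (- A) x)" by (auto intro!: la_eqI)
  with sc show ?case by (simp add: sc_sum[symmetric] mult.commute)
next
  case (gm T)
  then have T: "even (card T)" using assms by (auto simp: even_la_def)
  let ?W = "A \<times> (UNIV :: bool set)"
  have W: "finite ?W" "card ?W = 2 * card A" using assms by (simp_all add: card_cartesian_product)
  have "gm S * gm T * star (gm S) = sc (comm_sgn S T) (gm T)" if "S \<in> Pow ?W" for S
    using that W finite_subset[of S ?W] \<open>finite T\<close>
    by (simp add: gm_commute[of S T] mult.assoc)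
  then have "(\<Sum>S\<in>Pow ?W. gm S * gm T * star (gm S)) = (\<Sum>S\<in>Pow ?W. sc (comm_sgn S T) (gm T))"
    by (rule sum.cong[OF refl])
  also have "\<dots> = sc (\<Sum>S\<in>Pow ?W. comm_sgn S T) (gm T)"
    by (induction "Pow ?W" rule: infinite_finite_induct) (simp_all add: la_eqI sum_distrib_right)
  also have "(\<Sum>S\<in>Pow ?W. comm_sgn S T) = (if ?W \<inter> T = {} then 2 ^ card ?W else 0)"
    by (rule sum_comm_sgn_Pow[OF W(1) \<open>finite T\<close> T])
  also have "?W \<inter> T = {} \<longleftrightarrow> T \<subseteq> (- A) \<times> UNIV" by auto
  also have "sc (if T \<subseteq> (- A) \<times> UNIV then 2 ^ card ?W else 0) (gm T) = sc (4 ^ card A) (restr (- A) (gm T))"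
    using W(2) by (intro la_eqI) (simp add: power_mult)
  finally show ?case .
qed

section \<open>Minimal projections\<close>

definition mtr :: "'g set \<Rightarrow> 'g la \<Rightarrow> complex" where
  "mtr I x = 2 ^ card I * tr x"

lemma mtr_simps [simp]:
  "mtr I 0 = 0" "mtr I (x + y) = mtr I x + mtr I y" "mtr I (x - y) = mtr I x - mtr I y"
  "mtr I (- x) = - mtr I x" "mtr I (sc a x) = a * mtr I x" "mtr I (sum f F) = (\<Sum>i\<in>F. mtr I (f i))"
  by (simp_all add: mtr_def sum_distrib_left algebra_simps flip: sum_distrib_right)

lemma mtr_commute: "mtr I (x * y) = mtr I (y * x)"
  by (simp add: mtr_def tr_commute)

lemma mtr_hs: "mtr I (star x * x) = of_real (2 ^ card I * hs x)"
  by (simp add: mtr_def tr_star_hs)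

text \<open>The parity operator of a site; e in vac I is the common eigenprojection for eigenvalue 1.\<close>

definition zz :: "'g::countable \<Rightarrow> 'g la" where
  "zz i = sc \<i> (gm {(i, False)} * gm {(i, True)})"

lemma gm_singleton:
  "gm {p} * gm {p} = 1" "p \<noteq> q \<Longrightarrow> gm {p} * gm {q} = - (gm {q} * gm {p})" "star (gm {p}) = gm {p}"
proof -
  have "csgn {p} {p} = 1" by (simp add: csgn_self)
  then show "gm {p} * gm {p} = 1" "star (gm {p}) = gm {p}" by (simp_all add: gm_mult star_gm)
  show "gm {p} * gm {q} = - (gm {q} * gm {p})" if "p \<noteq> q"
    using that by (simp add: gm_commute[of "{p}" "{q}"] comm_sgn_disjoint)
qed

lemma zz_star: "star (zz i) = zz i"
  using gm_singleton(2)[of "(i, False)" "(i, True)"] by (simp add: zz_def gm_singleton(3))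

lemma zz_square: "zz i * zz i = 1"
proof -
  let ?a = "gm {(i, False)}" and ?b = "gm {(i, True)}"
  have "(?a * ?b) * (?a * ?b) = ?a * (?b * ?a) * ?b" by (simp add: mult.assoc)
  also have "?b * ?a = - (?a * ?b)" by (rule gm_singleton) simp
  also have "?a * (- (?a * ?b)) * ?b = - ((?a * ?a) * (?b * ?b))" by (simp add: mult.assoc)
  finally show ?thesis by (simp add: zz_def gm_singleton(1))
qed

definition site :: "'g \<Rightarrow> ('g \<times> bool) set" where "site i = {(i, False), (i, True)}"

lemma site_simps [simp]: "finite (site i)" "card (site i) = 2" "i \<in> I \<Longrightarrow> site i \<subseteq> I \<times> UNIV"
  by (auto simp: site_def)

lemma zz_site: "\<exists>c. c \<noteq> 0 \<and> zz i = sc c (gm (site i))"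
proof -
  have "symdiff {(i, False)} {(i, True)} = site i" by (auto simp: symdiff_def site_def)
  then show ?thesis
    by (intro exI[of _ "\<i> * csgn {(i, False)} {(i, True)}"]) (simp add: zz_def gm_mult)
qed

lemma on_reg_zz [simp]: "i \<in> I \<Longrightarrow> on_reg I (zz i)"
  using zz_site[of i] by (metis on_reg_gm on_reg_simps(3) site_simps(3))

lemma even_la_zz [simp]: "even_la (zz i)"
  using zz_site[of i] by (metis even_la_simps site_simps(2) dvd_refl)

definition vac :: "'g set \<Rightarrow> 'g::countable la \<Rightarrow> bool" where
  "vac I e \<longleftrightarrow> on_reg I e \<and> even_la e \<and> star e = e \<and> e * e = e \<and> mtr I e = 1 \<and>
     (\<forall>i\<in>I. zz i * e = e \<and> e * zz i = e)"

text \<open>e is the product over the sites of (1 + zz i)/2. The factors are even projections on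
  disjoint sites, so they commute, and each has normalised trace 1/2, which the factor 2^|I| in
  \<open>mtr\<close> compensates.\<close>

lemma vac_exists:
  assumes "finite I"
  shows "\<exists>e. vac I e"
  using assms
proof (induction I rule: finite_induct)
  case empty
  show ?case by (intro exI[of _ 1]) (simp add: vac_def mtr_def)
next
  case (insert i I)
  then obtain e where e: "on_reg I e" "even_la e" "star e = e" "e * e = e" "mtr I e = 1"
    "\<And>j. j \<in> I \<Longrightarrow> zz j * e = e" "\<And>j. j \<in> I \<Longrightarrow> e * zz j = e"
    by (auto simp: vac_def)
  define f where "f = sc (1/2) (1 + zz i)"
  have f: "on_reg {i} f" "even_la f" "star f = f" "tr f = 1/2"
  proof -
    have "tr (zz i) = 0" by (simp add: zz_def tr_gm_mult)
    then show "tr f = 1/2" by (simp add: f_def)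
  qed (simp_all add: f_def zz_star)
  have zf: "zz i * f = f" "f * zz i = f"
    by (simp_all add: f_def algebra_simps zz_square)
  have "f * f = sc (1/2) (f + f * zz i)" by (subst (2) f_def) (simp add: distrib_left)
  also have "\<dots> = sc (1/2) (f + f)" by (simp add: zf)
  also have "\<dots> = f" by (auto intro: la_eqI)
  finally have ff: "f * f = f" .
  have fx: "f * x = x * f" if "on_reg I x" for x
    using even_commute[OF f(2,1) that] insert by auto
  have zx: "zz i * x = x * zz i" if "on_reg I x" for x
    using even_commute[OF even_la_zz[of i] on_reg_zz[of i "{i}"] that] insert by auto
  have "vac (insert i I) (e * f)"
    unfolding vac_def
  proof (intro conjI ballI)
    have "on_reg (insert i I) e" "on_reg (insert i I) f"
      using e(1) f(1) by (blast intro: on_reg_mono)+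
    then show "on_reg (insert i I) (e * f)" by simp
    show "even_la (e * f)" using e f by simp
    show "star (e * f) = e * f" using e f fx by simp
    have "e * f * (e * f) = e * (f * e) * f" by (simp add: mult.assoc)
    also have "\<dots> = e * e * (f * f)" using fx e(1) by (simp add: mult.assoc)
    finally show "e * f * (e * f) = e * f" using e ff by simp
    show "mtr (insert i I) (e * f) = 1"
    proof -
      have "tr (e * f) = tr e * (1 / 2)"
        using tr_mult_disjoint[OF e(1) f(1)] insert.hyps by (simp add: f(4))
      then have "mtr (insert i I) (e * f) = mtr I e"
        using insert.hyps by (simp only: mtr_def card_insert_disjoint power_Suc) simp
      then show ?thesis using e(5) by simp
    qed
  next
    fix j assume j: "j \<in> insert i I"
    show "zz j * (e * f) = e * f"
    proof (cases "j = i")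
      case True
      have "zz i * (e * f) = e * (zz i * f)" using zx e(1) by (simp add: mult.assoc[symmetric])
      then show ?thesis using True zf by simp
    qed (use j e in \<open>simp add: mult.assoc[symmetric]\<close>)
    show "e * f * zz j = e * f"
    proof (cases "j = i")
      case True
      then show ?thesis using zf by (simp add: mult.assoc)
    next
      case False
      then have "f * zz j = zz j * f" using fx j by simp
      then have "e * f * zz j = e * zz j * f" by (simp add: mult.assoc)
      then show ?thesis using e False j by simp
    qed
  qed
  then show ?case by blast
qed

text \<open>If S contains both indices of a site, the pair is a multiple of its parity operator and
  is absorbed by e, leaving a smaller S. If it contains just one of them, \<open>gm S\<close>
  anticommutes with the parity operator and the compression vanishes.\<close>

lemma vac_compress_gm:
  assumes e: "vac I e" and "finite S" "S \<subseteq> I \<times> UNIV"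
  shows "\<exists>c. e * gm S * e = sc c e"
  using assms(2,3)
proof (induction "card S" arbitrary: S rule: less_induct)
  case less
  show ?case
  proof (cases "S = {}")
    case True
    then show ?thesis using e by (intro exI[of _ 1]) (simp add: vac_def)
  next
    case False
    then obtain i b where ib: "(i, b) \<in> S" by auto
    then have i: "i \<in> I" using less by auto
    have ze: "zz i * e = e" "e * zz i = e" using e i by (auto simp: vac_def)
    obtain c where c: "c \<noteq> 0" "zz i = sc c (gm (site i))" using zz_site by blast
    show ?thesis
    proof (cases "site i \<subseteq> S")
      case True
      let ?R = "S - site i"
      have R: "symdiff ?R (site i) = S" using True by (auto simp: symdiff_def)
      have "card ?R < card S"
        using True less(2) ib by (intro psubset_card_mono) (auto simp: site_def)
      then obtain d where d: "e * gm ?R * e = sc d e"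
        using less(1)[of ?R] less by auto
      have "gm ?R * gm (site i) = sc (csgn ?R (site i)) (gm S)"
        using less R by (simp add: gm_mult)
      then have "gm S = sc (csgn ?R (site i)) (gm ?R * gm (site i))" by simp
      also have "gm (site i) = sc (inverse c) (zz i)" using c by simp
      finally have "gm S = sc (csgn ?R (site i) * inverse c) (gm ?R * zz i)" by simp
      then have "e * gm S * e = sc (csgn ?R (site i) * inverse c) (e * gm ?R * (zz i * e))"
        by (simp add: mult.assoc)
      then show ?thesis using d ze by auto
    next
      case False
      have "S \<inter> site i = {(i, b)}" using ib False by (cases b) (auto simp: site_def)
      then have "(\<Prod>s\<in>S. if s \<in> site i then - 1 else 1 :: complex) = -1"
        using less(2) by (simp add: prod.inter_restrict[symmetric])
      then have "comm_sgn S (site i) = -1"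
        using less(2) by (simp add: comm_sgn_even)
      then have comm: "gm S * zz i = - (zz i * gm S)"
        using c less(2) gm_commute[of S "site i"] by simp
      have "e * gm S * e = e * (gm S * zz i) * e" using ze(1) by (simp add: mult.assoc)
      also have "\<dots> = - (e * zz i * gm S * e)" by (simp only: comm) (simp add: mult.assoc)
      \<comment> \<open>Absorbing the parity operator on the right and on the left shows the
        compression to be its own negative.\<close>
      also have "\<dots> = - (e * gm S * e)" by (simp only: ze)
      finally have "e * gm S * e + e * gm S * e = 0" by (simp only: eq_neg_iff_add_eq_0)
      then have "sc 2 (e * gm S * e) = 0"
        using sc_add_left[of 1 1 "e * gm S * e"] by simp
      then show ?thesis by (intro exI[of _ 0]) simp
    qed
  qed
qed

text \<open>Minimality of e: the compression of A(I) by e is one-dimensional. Since e has matrix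
  trace 1, taking traces identifies the scalar.\<close>

lemma vac_compress:
  assumes e: "vac I e" and x: "on_reg I x"
  shows "e * x * e = sc (mtr I (x * e)) e"
proof -
  have "\<exists>c. e * x * e = sc c e"
  proof (induction x rule: la_support_induct)
    case zero show ?case by (intro exI[of _ 0]) simp
  next
    case (add y z)
    then show ?case by (metis distrib_left distrib_right sc_add_left)
  next
    case (sc a y)
    then show ?case by (metis sc_left sc_right sc_simps(1))
  next
    case (gm S)
    then show ?case using vac_compress_gm[OF e] x by (simp add: on_reg_iff)
  qed
  then obtain c where c: "e * x * e = sc c e" by blast
  have "mtr I (e * x * e) = mtr I (x * e * e)"
    by (metis mtr_commute mult.assoc)
  then have "c = mtr I (x * e)" using e c by (simp add: vac_def mult.assoc)
  with c show ?thesis by simp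
qed

text \<open>The conjugates of e by all monomials on I add up to a nonzero multiple of 1, so an x
  that annihilates every \<open>gm S * e\<close> is 0. This provides nonzero starting vectors for
  the eigenvector search.\<close>

lemma vac_separating:
  assumes "finite I" "vac I e" "x \<noteq> 0"
  shows "\<exists>S\<subseteq>I \<times> UNIV. x * gm S * e \<noteq> 0"
proof (rule ccontr)
  assume *: "\<not> ?thesis"
  \<comment> \<open>e lives on I, so the empty monomial is the only one of its monomials that avoids
    I.\<close>
  have "restr (- I) e = sc (tr e) 1"
  proof (rule la_eqI)
    fix S :: "('a \<times> bool) set" assume "finite S"
    have "coef e S = 0" if "S \<subseteq> (- I) \<times> UNIV" "S \<noteq> {}"
    proof (rule ccontr)
      assume "coef e S \<noteq> 0"
      then have "S \<subseteq> I \<times> UNIV" using assms(2) by (auto simp: vac_def on_reg_iff)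
      with that show False by auto
    qed
    then show "coef (restr (- I) e) S = coef (sc (tr e) 1) S" by (auto simp: tr_def)
  qed
  then have "sc (4 ^ card I * tr e) x = x * (\<Sum>S\<in>Pow (I \<times> UNIV). gm S * e * star (gm S))"
    using twirl[OF assms(1), of e] assms(2) by (simp add: vac_def)
  also have "\<dots> = (\<Sum>S\<in>Pow (I \<times> UNIV). x * gm S * e * star (gm S))"
    by (simp add: sum_distrib_left mult.assoc)
  also have "\<dots> = 0" using * by (intro sum.neutral) auto
  finally have "tr e = 0" using assms(3) by simp
  then show False using assms(2) by (simp add: vac_def mtr_def)
qed

text \<open>The last clause, that q compresses A(I) to multiples of q, expresses rank one inside the
  algebra; \<open>mtr I (q * x)\<close> is then the expectation of x in the pure state of q.\<close>

definition min_proj :: "'g set \<Rightarrow> 'g::countable la \<Rightarrow> bool" where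
  "min_proj I q \<longleftrightarrow> on_reg I q \<and> star q = q \<and> q * q = q \<and> mtr I q = 1 \<and>
     (\<forall>x. on_reg I x \<longrightarrow> q * x * q = sc (mtr I (q * x)) q)"

text \<open>Elements w with \<open>w * e = w\<close> behave like vectors:
  \<open>star w * x * w\<close> is compressed by e and hence is a scalar times e, the scalar being a
  matrix element of x. So \<open>w * star w\<close> is the rank-one operator of w, up to
  normalisation.\<close>

lemma min_proj_of_vector:
  assumes e: "vac I e" and w: "on_reg I w" "w * e = w" "w \<noteq> 0"
  shows "\<exists>l>0. min_proj I (sc (of_real l) (w * star w))"
proof -
  \<comment> \<open>The squared length of w: \<open>star w * w\<close> turns out to be k times
    e.\<close>
  define k where "k = 2 ^ card I * hs w"
  have "hs w > 0" using w(3) hs_nonneg[of w] hs_eq_0_iff[of w] by linarith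
  then have k: "k > 0" by (simp add: k_def)
  have ee: "star e = e" "e * e = e" "mtr I e = 1" using e by (auto simp: vac_def)
  have ew: "e * star w = star w" using w(2) ee by (metis star_mult)
  have comp: "star w * x * w = sc (mtr I (star w * x * w)) e" if "on_reg I x" for x
  proof -
    have "star w * x * w = e * (star w * x * w) * e" using ew w(2) by (simp add: mult.assoc) (metis mult.assoc)
    also have "\<dots> = sc (mtr I (star w * x * w * e)) e"
      using vac_compress[OF e, of "star w * x * w"] that w by simp
    finally show ?thesis using w(2) by (simp add: mult.assoc)
  qed
  have ww: "star w * w = sc (of_real k) e"
    using comp[of 1] by (simp add: mtr_hs k_def)
  let ?q = "sc (of_real (1/k)) (w * star w)"
  have qxq: "?q * x * ?q = sc (mtr I (?q * x)) ?q" if "on_reg I x" for x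
  proof -
    have "?q * x * ?q = sc (of_real (1/k) * of_real (1/k)) (w * (star w * x * w) * star w)"
      by (simp add: mult.assoc)
    also have "\<dots> = sc (of_real (1/k) * of_real (1/k) * mtr I (star w * x * w)) (w * star w)"
      by (subst comp[OF that]) (simp add: w(2) )
    also have "mtr I (star w * x * w) = mtr I (w * star w * x)"
      by (metis mtr_commute mult.assoc)
    finally show ?thesis by simp
  qed
  have "min_proj I ?q"
    unfolding min_proj_def
  proof (intro conjI allI impI qxq)
    show mt: "mtr I ?q = 1"
      using ww k mtr_commute[of I w "star w"] ee by simp
    show "?q * ?q = ?q" using qxq[of 1] mt by simp
  qed (use w in simp_all)
  then show ?thesis using k by (intro exI[of _ "1/k"]) auto
qed

section \<open>The spectral theorem\<close>

text \<open>Gaussian elimination on a homogeneous system with more unknowns (K) than equations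
  (X).\<close>

lemma linear_dependence:
  fixes f :: "'k \<Rightarrow> 'x \<Rightarrow> complex"
  assumes "finite X" "finite K" "card X < card K"
  shows "\<exists>a. (\<exists>k\<in>K. a k \<noteq> 0) \<and> (\<forall>x\<in>X. (\<Sum>k\<in>K. a k * f k x) = 0)"
  using assms
proof (induction X arbitrary: K f rule: finite_induct)
  case empty
  then obtain k where "k \<in> K" by fastforce
  then show ?case by (intro exI[of _ "\<lambda>_. 1"]) auto
next
  case (insert x X)
  show ?case
  proof (cases "\<forall>k\<in>K. f k x = 0")
    case True
    have "card X < card K" using insert by simp
    then obtain a where "\<exists>k\<in>K. a k \<noteq> 0" "\<forall>x\<in>X. (\<Sum>k\<in>K. a k * f k x) = 0"
      using insert.IH[of K f] insert.prems by auto
    with True show ?thesis by (intro exI[of _ a]) auto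
  next
    case False
    then obtain j where j: "j \<in> K" "f j x \<noteq> 0" by blast
    let ?K = "K - {j}"
    \<comment> \<open>Column j is the pivot; subtracting its multiple clears equation x from all
      other columns.\<close>
    define g where "g k y = f k y - f k x / f j x * f j y" for k y
    have "card X < card ?K" using insert j by simp
    then obtain b where b: "\<exists>k\<in>?K. b k \<noteq> 0" "\<And>y. y \<in> X \<Longrightarrow> (\<Sum>k\<in>?K. b k * g k y) = 0"
      using insert.IH[of ?K g] insert.prems by auto
    \<comment> \<open>The value of the pivot unknown, up to sign, that makes equation x
      hold.\<close>
    define c where "c = (\<Sum>k\<in>?K. b k * f k x) / f j x"
    define a where "a = b(j := - c)"
    have split: "(\<Sum>k\<in>K. a k * f k y) = (\<Sum>k\<in>?K. b k * f k y) - c * f j y" for y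
    proof -
      have "(\<Sum>k\<in>K. a k * f k y) = a j * f j y + (\<Sum>k\<in>?K. a k * f k y)"
        using insert.prems j by (simp add: sum.remove)
      also have "(\<Sum>k\<in>?K. a k * f k y) = (\<Sum>k\<in>?K. b k * f k y)"
        by (intro sum.cong) (auto simp: a_def)
      finally show ?thesis by (simp add: a_def)
    qed
    have "(\<Sum>k\<in>K. a k * f k y) = 0" if "y \<in> insert x X" for y
    proof (cases "y = x")
      case True
      then show ?thesis using j unfolding split by (simp add: c_def)
    next
      case False
      have "(\<Sum>k\<in>?K. b k * f k y) - c * f j y = (\<Sum>k\<in>?K. b k * g k y)"
        by (simp add: g_def c_def algebra_simps sum_subtractf sum_distrib_left sum_divide_distrib)
      then show ?thesis using b False that unfolding split by auto
    qed
    moreover have "\<exists>k\<in>K. a k \<noteq> 0" using b(1) by (auto simp: a_def)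
    ultimately show ?thesis by blast
  qed
qed

text \<open>p(h) by Horner's scheme: the coefficients are complex scalars, the argument lies in a
  noncommutative algebra.\<close>

definition pev :: "'g::countable la \<Rightarrow> complex poly \<Rightarrow> 'g la" where
  "pev h p = fold_coeffs (\<lambda>a x. sc a 1 + h * x) p 0"

lemma pev_0 [simp]: "pev h 0 = 0"
  by (simp add: pev_def)

lemma pev_pCons [simp]: "pev h (pCons a p) = sc a 1 + h * pev h p"
  by (cases "p = 0 \<and> a = 0") (auto simp: pev_def)

lemma pev_add: "pev h (p + q) = pev h p + pev h q"
  by (induction p q rule: poly_induct2) (simp_all add: algebra_simps sc_add_left)

lemma pev_smult: "pev h (smult c p) = sc c (pev h p)"
  by (induction p) (simp_all add: sc_add)

lemma pev_sum: "pev h (sum f F) = (\<Sum>i\<in>F. pev h (f i))"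
  by (induction F rule: infinite_finite_induct) (simp_all add: pev_add)

lemma pev_monom: "pev h (monom a n) = sc a (h ^ n)"
  by (induction n) (simp_all add: monom_0 monom_Suc)

lemma pev_commute: "h * pev h p = pev h p * h"
proof (induction p)
  case (pCons a p)
  have "h * (h * pev h p) = h * (pev h p * h)" using pCons.IH by (rule arg_cong)
  then show ?case by (simp add: distrib_left distrib_right mult.assoc)
qed simp

lemma pev_linear_factor: "pev h ([:- z, 1:] * p) = pev h p * (h - sc z 1)"
proof -
  have "[:- z, 1:] * p = smult (- z) p + pCons 0 p" by simp
  then have "pev h ([:- z, 1:] * p) = h * pev h p - sc z (pev h p)"
    by (simp only: pev_add pev_smult pev_pCons) simp
  then show ?thesis by (simp add: pev_commute right_diff_distrib)
qed

text \<open>Split off a root z of p. Either v is an eigenvector for z, or (h - z) v is a nonzero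
  vector annihilated by a polynomial of smaller degree. The closure of V under h - z keeps the
  search inside V.\<close>

lemma eigenvector_of_annihilating_poly:
  assumes V: "\<And>z v. V v \<Longrightarrow> V (h * v - sc z v)"
    and "p \<noteq> 0" "V v" "v \<noteq> 0" "pev h p * v = 0"
  shows "\<exists>w z. V w \<and> w \<noteq> 0 \<and> h * w = sc z w"
  using assms(2-)
proof (induction "degree p" arbitrary: p v)
  case 0
  then obtain c where c: "p = [:c:]" by (metis degree_eq_zeroE)
  with 0 show ?case by simp
next
  case (Suc n)
  then have "\<not> constant (poly p)" by (simp add: constant_degree)
  then obtain z where "poly p z = 0" using fundamental_theorem_of_algebra by blast
  then obtain q where q: "p = [:- z, 1:] * q" by (metis poly_eq_0_iff_dvd dvdE)
  show ?case
  proof (cases "h * v - sc z v = 0")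
    case True
    then show ?thesis using Suc by auto
  next
    case False
    have "q \<noteq> 0" using q Suc by auto
    then have "degree p = Suc (degree q)" unfolding q by (subst degree_mult_eq) auto
    moreover have "pev h q * (h * v - sc z v) = 0"
      using Suc.prems(4) unfolding q pev_linear_factor by (simp add: mult.assoc left_diff_distrib)
    ultimately show ?thesis
      using Suc.hyps(1)[of q "h * v - sc z v"] Suc.hyps(2) Suc.prems \<open>q \<noteq> 0\<close> False V by auto
  qed
qed

lemma annihilating_poly_exists:
  assumes I: "finite I" and h: "on_reg I h" and v: "on_reg I v"
  shows "\<exists>p. p \<noteq> 0 \<and> pev h p * v = 0"
proof -
  let ?X = "Pow (I \<times> (UNIV :: bool set))"
  \<comment> \<open>One power of h more than the dimension of A(I), which forces a linear relation
    among the vectors h^k v.\<close>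
  let ?K = "{..card ?X}"
  obtain a where a: "\<exists>k\<in>?K. a k \<noteq> 0" "\<forall>S\<in>?X. (\<Sum>k\<in>?K. a k * coef (h ^ k * v) S) = 0"
    using linear_dependence[of ?X ?K "\<lambda>k S. coef (h ^ k * v) S"] I by auto
  define p where "p = (\<Sum>k\<in>?K. monom (a k) k)"
  have "coeff p k = a k" if "k \<in> ?K" for k
    using that by (simp add: p_def coeff_sum if_distrib sum.delta cong: if_cong)
  then have "p \<noteq> 0" using a(1) by (metis coeff_0)
  moreover have "pev h p * v = 0"
  proof (rule la_eqI)
    fix S :: "('a \<times> bool) set"
    have eq: "pev h p * v = (\<Sum>k\<in>?K. sc (a k) (h ^ k * v))"
      by (simp add: p_def pev_sum pev_monom sum_distrib_right)
    show "coef (pev h p * v) S = coef 0 S"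
    proof (cases "S \<in> ?X")
      case True
      then show ?thesis using a(2) unfolding eq by simp
    next
      case False
      have "on_reg I (pev h p * v)" unfolding eq using h v by simp
      with False show ?thesis by (auto simp: on_reg_iff)
    qed
  qed
  ultimately show ?thesis by blast
qed

lemma eigenvalue_real:
  assumes "star h = h" "h * w = sc z w" "w \<noteq> 0"
  shows "z = of_real (Re z)"
proof -
  have 1: "tr (star w * (h * w)) = z * of_real (hs w)"
    using assms(2) by (simp add: tr_star_hs)
  have "star (star w * (h * w)) = star w * (h * w)" using assms(1) by (simp add: mult.assoc)
  then have "cnj (tr (star w * (h * w))) = tr (star w * (h * w))" by (metis tr_star)
  then have "cnj z * of_real (hs w) = z * of_real (hs w)" unfolding 1 by simp
  then have "cnj z = z" using assms(3) by simp
  then show ?thesis by (simp add: complex_eq_iff)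
qed

text \<open>The elements w = P w = w e of A(I) form a space stable under h, because h commutes with
  P, and it is nonzero by \<open>vac_separating\<close>. An eigenvector in it gives a rank-one
  projection below P.\<close>

lemma eigenprojection_exists:
  assumes I: "finite I" and h: "on_reg I h" "star h = h"
    and P: "on_reg I P" "P * P = P" "h * P = P * h" "P \<noteq> 0"
  shows "\<exists>q r. min_proj I q \<and> P * q = q \<and> h * q = sc (of_real r) q"
proof -
  obtain e where e: "vac I e" using vac_exists[OF I] by blast
  then have ee: "on_reg I e" "e * e = e" by (auto simp: vac_def)
  obtain S where S: "S \<subseteq> I \<times> UNIV" "P * gm S * e \<noteq> 0"
    using vac_separating[OF I e P(4)] by blast
  define V where "V w \<longleftrightarrow> on_reg I w \<and> P * w = w \<and> w * e = w" for w
  have "V (h * w - sc z w)" if "V w" for w z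
  proof -
    have "P * (h * w) = h * (P * w)" using P(3) by (metis mult.assoc)
    then show ?thesis using that h(1)
      by (simp add: V_def right_diff_distrib left_diff_distrib mult.assoc)
  qed
  moreover have V: "V (P * gm S * e)"
    using P ee S(1) by (simp add: V_def mult.assoc) (simp add: mult.assoc[symmetric])
  moreover obtain p where "p \<noteq> 0" "pev h p * (P * gm S * e) = 0"
    using annihilating_poly_exists[OF I h(1)] V by (metis V_def)
  ultimately obtain w z where w: "V w" "w \<noteq> 0" "h * w = sc z w"
    using eigenvector_of_annihilating_poly[of V h p "P * gm S * e"] S(2) by blast
  obtain l where l: "l > 0" "min_proj I (sc (of_real l) (w * star w))"
    using min_proj_of_vector[OF e, of w] w by (auto simp: V_def)
  have "P * (w * star w) = w * star w" "h * (w * star w) = sc z (w * star w)"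
    using w by (simp_all add: V_def mult.assoc[symmetric])
  then show ?thesis
    using l eigenvalue_real[OF h(2) w(3,2)]
    by (intro exI[of _ "sc (of_real l) (w * star w)"] exI[of _ "Re z"]) (simp add: mult.commute)
qed

text \<open>Eigenvalues with multiplicity: r lists them along a set Q of rank-one projections, so that
  repeated eigenvalues are attached to different elements of Q.\<close>

definition spectral :: "'g set \<Rightarrow> 'g::countable la \<Rightarrow> 'g la set \<Rightarrow> ('g la \<Rightarrow> real) \<Rightarrow> bool" where
  "spectral I h Q r \<longleftrightarrow> finite Q \<and> (\<forall>q\<in>Q. min_proj I q \<and> h * q = sc (of_real (r q)) q) \<and>
     (\<forall>q\<in>Q. \<forall>q'\<in>Q. q \<noteq> q' \<longrightarrow> q * q' = 0) \<and> \<Sum>Q = 1"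

text \<open>Rank-one eigenprojections are peeled off P one at a time; each lowers the matrix trace
  by 1, so a strict bound k on the trace bounds the number of steps.\<close>

lemma spectral_subprojection:
  assumes I: "finite I" and h: "on_reg I h" "star h = h"
    and P: "on_reg I P" "star P = P" "P * P = P" "h * P = P * h" "Re (mtr I P) < real k"
  shows "\<exists>Q r. finite Q \<and> (\<forall>q\<in>Q. min_proj I q \<and> P * q = q \<and> h * q = sc (of_real (r q)) q) \<and>
     (\<forall>q\<in>Q. \<forall>q'\<in>Q. q \<noteq> q' \<longrightarrow> q * q' = 0) \<and> \<Sum>Q = P"
  using P
proof (induction k arbitrary: P)
  case 0
  \<comment> \<open>As P = \<open>star P * P\<close>, its trace is nonnegative, which excludes a
    trace below 0.\<close>
  have "Re (mtr I (star P * P)) \<ge> 0" by (subst mtr_hs) simp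
  with 0 show ?case by simp
next
  case (Suc k)
  show ?case
  proof (cases "P = 0")
    case True
    then show ?thesis by (intro exI[of _ "{}"]) simp
  next
    case False
    then obtain q t where q: "min_proj I q" "P * q = q" "h * q = sc (of_real t) q"
      using eigenprojection_exists[OF I h] Suc.prems by blast
    then have q': "on_reg I q" "star q = q" "q * q = q" "mtr I q = 1" by (auto simp: min_proj_def)
    have qP: "q * P = q" using q(2) q'(2) Suc.prems(2) by (metis star_mult)
    \<comment> \<open>Together with \<open>h * q = t q\<close> this makes h commute with q, hence
      with P - q, as the induction hypothesis requires.\<close>
    have qh: "q * h = sc (of_real t) q"
    proof -
      have "star (h * q) = star (sc (of_real t) q)" using q(3) by simp
      then show ?thesis using h(2) q'(2) by simp
    qed
    let ?P = "P - q"
    have "\<exists>Q r. finite Q \<and> (\<forall>q\<in>Q. min_proj I q \<and> ?P * q = q \<and> h * q = sc (of_real (r q)) q) \<and>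
     (\<forall>q\<in>Q. \<forall>q'\<in>Q. q \<noteq> q' \<longrightarrow> q * q' = 0) \<and> \<Sum>Q = ?P"
      using Suc.prems q' q qP qh
      by (intro Suc.IH) (simp_all add: left_diff_distrib right_diff_distrib)
    then obtain Q r where "finite Q" "\<Sum>Q = ?P"
      "\<forall>q\<in>Q. min_proj I q \<and> ?P * q = q \<and> h * q = sc (of_real (r q)) q"
      "\<forall>q\<in>Q. \<forall>q'\<in>Q. q \<noteq> q' \<longrightarrow> q * q' = 0" by (elim exE conjE) (rule that)
    then have Q: "finite Q" "\<Sum>Q = ?P"
      "\<And>p. p \<in> Q \<Longrightarrow> min_proj I p \<and> ?P * p = p \<and> h * p = sc (of_real (r p)) p"
      "\<And>p p'. p \<in> Q \<Longrightarrow> p' \<in> Q \<Longrightarrow> p \<noteq> p' \<Longrightarrow> p * p' = 0" by simp_all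
    have P': "P * ?P = ?P" "q * ?P = 0" using Suc.prems(3) q(2) qP q'(3) by (simp_all add: right_diff_distrib)
    have Pp: "P * p = p" if "p \<in> Q" for p using Q(3)[OF that] P'(1) by (metis mult.assoc)
    have qp: "q * p = 0" if "p \<in> Q" for p
      using Q(3)[OF that] P'(2) by (metis mult.assoc mult_zero_left)
    have pq: "p * q = 0" if "p \<in> Q" for p
    proof -
      have "star (q * p) = 0" using qp[OF that] by simp
      then show ?thesis using Q(3)[OF that] q'(2) by (simp add: min_proj_def)
    qed
    have "q \<notin> Q"
    proof
      assume "q \<in> Q"
      then have "q = 0" using qp q'(3) by metis
      then show False using q'(4) by simp
    qed
    show ?thesis
    proof (intro exI[of _ "insert q Q"] exI[of _ "r(q := t)"] conjI ballI impI)
      show "\<Sum>(insert q Q) = P" using Q \<open>q \<notin> Q\<close> by simp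
    qed (use Q q Pp qp pq \<open>q \<notin> Q\<close> in \<open>auto simp del: fun_upd_apply simp: fun_upd_def\<close>)
  qed
qed

lemma spectral_exists:
  assumes "finite I" "on_reg I h" "star h = h"
  shows "\<exists>Q r. spectral I h Q r"
proof -
  obtain k where "Re (mtr I 1) < real k" using reals_Archimedean2 by blast
  then show ?thesis
    using spectral_subprojection[OF assms, of 1 k] unfolding spectral_def by auto
qed

lemma spectral_power:
  assumes "spectral I h Q r"
  shows "h ^ n = (\<Sum>q\<in>Q. sc (of_real (r q ^ n)) q)"
proof -
  have "h ^ n * q = sc (of_real (r q ^ n)) q" if "q \<in> Q" for q
    using that assms by (induction n) (auto simp: spectral_def mult.assoc mult.commute)
  then have "h ^ n * \<Sum>Q = (\<Sum>q\<in>Q. sc (of_real (r q ^ n)) q)"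
    by (simp add: sum_distrib_left)
  then show ?thesis using assms by (simp add: spectral_def)
qed

lemma spectral_expand:
  assumes "spectral I h Q r"
  shows "h = (\<Sum>q\<in>Q. sc (of_real (r q)) q)"
  using spectral_power[OF assms, of 1] by simp

lemma spectral_moment:
  assumes "spectral I h Q r"
  shows "mtr I (h ^ n) = of_real (\<Sum>q\<in>Q. r q ^ n)"
proof -
  have "mtr I q = 1" if "q \<in> Q" for q using assms that by (auto simp: spectral_def min_proj_def)
  then show ?thesis by (simp add: spectral_power[OF assms])
qed

section \<open>States, density matrices and entropy\<close>

text \<open>Equal moments give equal sums of every polynomial, and a polynomial vanishing at all
  elements but a reads off the multiplicity of a. This makes the description in
  \<open>dens_spec\<close> definite.\<close>

lemma moments_determine_multiset:
  fixes M N :: "real multiset"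
  assumes "\<And>n. (\<Sum>l\<in>#M. l ^ n) = (\<Sum>l\<in>#N. l ^ n)"
  shows "M = N"
proof (rule multiset_eqI)
  fix a
  have poly: "(\<Sum>l\<in>#M. poly p l) = (\<Sum>l\<in>#N. poly p l)" for p
  proof -
    have "(\<Sum>l\<in>#K. poly p l) = (\<Sum>i\<le>degree p. coeff p i * (\<Sum>l\<in>#K. l ^ i))" for K
      by (induction K) (simp_all add: poly_altdef algebra_simps sum.distrib)
    with assms show ?thesis by simp
  qed
  define X where "X = (set_mset M \<union> set_mset N) - {a}"
  define p where "p = (\<Prod>y\<in>X. [:- y, 1:])"
  have fX: "finite X" by (simp add: X_def)
  have pa: "poly p a \<noteq> 0" using fX by (auto simp: p_def poly_prod X_def)
  have p0: "poly p y = 0" if "y \<in> X" for y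
    using fX that by (auto simp: p_def poly_prod)
  have cnt: "(\<Sum>l\<in>#K. poly p l) = of_nat (count K a) * poly p a" if "set_mset K - {a} \<subseteq> X" for K
    using that
  proof (induction K)
    case (add x K)
    then have "set_mset K - {a} \<subseteq> X" "x \<noteq> a \<Longrightarrow> x \<in> X" by auto
    then show ?case using add.IH p0[of x] by (cases "x = a") (simp_all add: algebra_simps)
  qed simp
  have "set_mset M - {a} \<subseteq> X" "set_mset N - {a} \<subseteq> X" by (auto simp: X_def)
  then have "of_nat (count M a) * poly p a = of_nat (count N a) * poly p a"
    using poly[of p] by (simp only: cnt)
  then show "count M a = count N a" using pa by simp
qed

section \<open>Translation of the definitions to local elements\<close>

lemma coef_mk_la: "loc f \<Longrightarrow> coef (mk_la f) = f"
  by (simp add: mk_la_inverse)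

lemma loc_iff_coef: "loc f \<longleftrightarrow> (\<exists>x. f = coef x)"
  by (metis coef_mk_la loc_coef)

lemma in_alg_coef: "in_alg I (coef x) \<longleftrightarrow> on_reg I x"
  by (simp add: in_alg_def on_reg_def)

lemma in_algE:
  assumes "in_alg I f"
  obtains x where "f = coef x" "on_reg I x"
  using assms by (metis in_alg_coef in_alg_def loc_iff_coef)

lemmas coef_ops = times_la.rep_eq[symmetric] plus_la.rep_eq[symmetric] sc.rep_eq[symmetric]
  star.rep_eq[symmetric] one_la.rep_eq[symmetric]

lemma mtrace_coef: "mtrace I (coef x) = mtr I x"
  by (simp add: mtrace_def mtr_def tau_def tr_def)

lemma cpow_coef: "cpow (coef x) n = coef (x ^ n)"
  by (induction n) (simp_all add: cpow_def coef_ops)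

definition ev :: "('g car \<Rightarrow> complex) \<Rightarrow> 'g la \<Rightarrow> complex" where
  "ev \<psi> x = \<psi> (coef x)"

lemma
  assumes "state \<psi>"
  shows ev_add: "ev \<psi> (x + y) = ev \<psi> x + ev \<psi> y"
    and ev_sc: "ev \<psi> (sc a x) = a * ev \<psi> x"
    and ev_one: "ev \<psi> 1 = 1"
    and ev_Im: "Im (ev \<psi> (star x * x)) = 0"
    and ev_nonneg: "Re (ev \<psi> (star x * x)) \<ge> 0"
  using assms loc_coef[of x] loc_coef[of y] unfolding state_def ev_def
  by (simp_all add: times_la.rep_eq plus_la.rep_eq sc.rep_eq star.rep_eq one_la.rep_eq)

lemma ev_zero: "state \<psi> \<Longrightarrow> ev \<psi> 0 = 0"
  using ev_sc[of \<psi> 0 0] by simp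

lemma ev_uminus: "state \<psi> \<Longrightarrow> ev \<psi> (- x) = - ev \<psi> x"
  using ev_sc[of \<psi> "-1" x] by simp

lemma ev_diff: "state \<psi> \<Longrightarrow> ev \<psi> (x - y) = ev \<psi> x - ev \<psi> y"
  using ev_add[of \<psi> x "- y"] ev_uminus by simp

lemma ev_sum: "state \<psi> \<Longrightarrow> ev \<psi> (sum f F) = (\<Sum>i\<in>F. ev \<psi> (f i))"
  by (induction F rule: infinite_finite_induct) (simp_all add: ev_zero ev_add)

lemmas ev_linear = ev_add ev_sc ev_one ev_zero ev_uminus ev_diff ev_sum

text \<open>Polarisation: reality on squares of 1 + y makes the value of y + star y real, and the
  cases y = x and y = i x give the real and the imaginary part.\<close>

lemma ev_star:
  assumes "state \<psi>"
  shows "ev \<psi> (star x) = cnj (ev \<psi> x)"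
proof -
  have *: "Im (ev \<psi> y + ev \<psi> (star y)) = 0" for y
    using ev_Im[OF assms, of "1 + y"] ev_Im[OF assms, of y] assms
    by (simp add: algebra_simps ev_linear)
  show ?thesis
    using *[of x] *[of "sc \<i> x"] assms by (simp add: ev_linear complex_eq_iff)
qed

text \<open>The expansion of the density matrix in orthonormal monomials: its coefficient at S is
  the normalised trace of its product with \<open>star (gm S)\<close>, which is the value of the
  state divided by 2^|I|.\<close>

definition rho :: "('g::countable car \<Rightarrow> complex) \<Rightarrow> 'g set \<Rightarrow> 'g la" where
  "rho \<psi> I = (\<Sum>S\<in>Pow (I \<times> UNIV). sc (ev \<psi> (star (gm S)) / 2 ^ card I) (gm S))"

lemma coef_rho:
  assumes "finite I"
  shows "coef (rho \<psi> I) S = (if S \<subseteq> I \<times> UNIV then ev \<psi> (star (gm S)) / 2 ^ card I else 0)"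
proof -
  have "coef (rho \<psi> I) S = (\<Sum>T\<in>Pow (I \<times> UNIV). if T = S then ev \<psi> (star (gm S)) / 2 ^ card I else 0)"
    unfolding rho_def coef_sum
  proof (intro sum.cong refl)
    fix T assume "T \<in> Pow (I \<times> (UNIV :: bool set))"
    then have "finite T" using assms by (meson PowD finite_SigmaI finite finite_subset)
    then show "coef (sc (ev \<psi> (star (gm T)) / 2 ^ card I) (gm T)) S =
        (if T = S then ev \<psi> (star (gm S)) / 2 ^ card I else 0)" by auto
  qed
  then show ?thesis using assms by (simp add: sum.delta)
qed

lemma on_reg_rho [simp]: "on_reg I (rho \<psi> I)"
  unfolding rho_def by (intro on_reg_sum) simp

lemma ev_rho:
  assumes \<psi>: "state \<psi>" and I: "finite I" and x: "on_reg I x"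
  shows "mtr I (rho \<psi> I * x) = ev \<psi> x"
proof (induction x rule: la_support_induct)
  case (gm S)
  then have "S \<subseteq> I \<times> UNIV" using x by (auto simp: on_reg_iff)
  then show ?case
    using gm(1) I \<psi> by (simp add: mtr_def tr_mult_gm coef_rho star_gm ev_sc)
qed (simp_all add: ev_linear[OF \<psi>] distrib_left)

lemma star_rho:
  assumes "state \<psi>" "finite I"
  shows "star (rho \<psi> I) = rho \<psi> I"
proof (rule la_eqI)
  fix S :: "('a \<times> bool) set"
  have a: "cnj (ev \<psi> (star (gm S))) = ev \<psi> (gm S)"
    using ev_star[OF assms(1), of "star (gm S)"] by simp
  have b: "ev \<psi> (star (gm S)) = ev \<psi> (gm S) * csgn S S"
    by (simp add: star_gm ev_sc[OF assms(1)])
  show "coef (star (rho \<psi> I)) S = coef (rho \<psi> I) S"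
    by (simp add: coef_star coef_rho[OF assms(2)] a) (simp add: b)
qed

lemma ev_gm_odd:
  assumes "state \<psi>" "even_state \<psi>" "odd (card S)"
  shows "ev \<psi> (gm S) = 0"
proof -
  have "grading (coef (gm S)) = coef (- gm S)"
    using assms(3) by (auto simp: grading_def fun_eq_iff)
  then have "ev \<psi> (- gm S) = ev \<psi> (gm S)"
    using assms(2) unfolding even_state_def ev_def by (metis loc_coef)
  then show ?thesis using assms(1) by (simp add: ev_uminus)
qed

lemma even_rho:
  assumes "state \<psi>" "even_state \<psi>" "finite I"
  shows "even_la (rho \<psi> I)"
  unfolding even_la_def using assms
  by (auto simp: coef_rho star_gm ev_sc dest: ev_gm_odd split: if_splits)

text \<open>Testing on the star of the difference gives it length zero; the trace is
  faithful.\<close>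

lemma rho_unique:
  assumes \<psi>: "state \<psi>" and I: "finite I" and y: "on_reg I y"
    and eq: "\<And>x. on_reg I x \<Longrightarrow> ev \<psi> x = mtr I (y * x)"
  shows "y = rho \<psi> I"
proof -
  let ?d = "y - rho \<psi> I"
  have "mtr I (?d * star ?d) = 0"
    using eq[of "star ?d"] ev_rho[OF \<psi> I, of "star ?d"] y by (simp add: left_diff_distrib)
  then have "mtr I (star ?d * ?d) = 0" by (simp add: mtr_commute)
  then show ?thesis unfolding mtr_hs by simp
qed

lemma dens_eq_rho:
  assumes \<psi>: "state \<psi>" and I: "finite I"
  shows "dens \<psi> I = coef (rho \<psi> I)"
  unfolding dens_def
proof (rule the_equality)
  have "\<psi> f = mtrace I (cmul (coef (rho \<psi> I)) f)" if f: "in_alg I f" for f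
  proof -
    obtain x where x: "f = coef x" "on_reg I x" using f by (rule in_algE)
    then show ?thesis using ev_rho[OF \<psi> I x(2)] by (simp add: coef_ops mtrace_coef ev_def)
  qed
  then show "in_alg I (coef (rho \<psi> I)) \<and> (\<forall>x. in_alg I x \<longrightarrow> \<psi> x = mtrace I (cmul (coef (rho \<psi> I)) x))"
    by (simp add: in_alg_coef)
next
  fix f assume f: "in_alg I f \<and> (\<forall>x. in_alg I x \<longrightarrow> \<psi> x = mtrace I (cmul f x))"
  then obtain y where y: "f = coef y" "on_reg I y" by (metis in_algE)
  have "ev \<psi> x = mtr I (y * x)" if "on_reg I x" for x
    using f that y by (simp add: in_alg_coef[symmetric] ev_def coef_ops mtrace_coef[symmetric])
  then have "y = rho \<psi> I" using rho_unique[OF \<psi> I y(2)] by blast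
  then show "f = coef (rho \<psi> I)" using y by simp
qed

definition eta :: "real \<Rightarrow> real" where
  "eta l = (if l = 0 then 0 else - l * ln l)"

text \<open>Any finite family with the right power sums lists the spectrum, whatever its index set;
  eigenprojections are not involved. For the product state the family is indexed by pairs.\<close>

lemma vN_entropy_moments:
  assumes \<psi>: "state \<psi>" and I: "finite I" and K: "finite K"
    and mom: "\<And>n. mtr I (rho \<psi> I ^ n) = of_real (\<Sum>k\<in>K. r k ^ n)"
  shows "vN_entropy \<psi> I = (\<Sum>k\<in>K. eta (r k))"
proof -
  let ?M = "image_mset r (mset_set K)"
  have M: "(\<Sum>l\<in>#?M. l ^ n) = (\<Sum>k\<in>K. r k ^ n)" for n
    by (simp add: sum_unfold_sum_mset image_mset.compositionality comp_def)
  have "dens_spec \<psi> I = ?M"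
    unfolding dens_spec_def dens_eq_rho[OF \<psi> I] cpow_coef mtrace_coef mom
  proof (rule the_equality)
    fix N :: "real multiset"
    assume "\<forall>n. complex_of_real (\<Sum>k\<in>K. r k ^ n) = of_real (\<Sum>l\<in>#N. l ^ n)"
    then have "(\<Sum>l\<in>#N. l ^ n) = (\<Sum>l\<in>#?M. l ^ n)" for n
      unfolding M by (metis of_real_eq_iff)
    then show "N = ?M" by (rule moments_determine_multiset)
  qed (simp add: M del: of_real_sum)
  then show ?thesis
    by (simp add: vN_entropy_def eta_def sum_unfold_sum_mset image_mset.compositionality comp_def)
qed

lemma vN_entropy_spectral:
  assumes "state \<psi>" "finite I" "spectral I (rho \<psi> I) Q r"
  shows "vN_entropy \<psi> I = (\<Sum>q\<in>Q. eta (r q))"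
  using assms by (intro vN_entropy_moments spectral_moment) (auto simp: spectral_def)

lemma spectral_rho_exists:
  assumes "state \<psi>" "finite I"
  shows "\<exists>Q r. spectral I (rho \<psi> I) Q r"
  by (rule spectral_exists[OF assms(2) on_reg_rho star_rho[OF assms]])

text \<open>The eigenvalue is the trace of \<open>rho\<close> times q, which is the value of the
  state on q = star q * q.\<close>

lemma spectral_rho_eigenvalue:
  assumes \<psi>: "state \<psi>" and I: "finite I" and s: "spectral I (rho \<psi> I) Q r" and q: "q \<in> Q"
  shows "ev \<psi> q = of_real (r q)" "r q \<ge> 0"
proof -
  have q': "on_reg I q" "star q = q" "q * q = q" "mtr I q = 1"
    "rho \<psi> I * q = sc (of_real (r q)) q"
    using s q by (auto simp: spectral_def min_proj_def)
  show e: "ev \<psi> q = of_real (r q)"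
    using ev_rho[OF \<psi> I q'(1)] q' by simp
  show "r q \<ge> 0" using ev_nonneg[OF \<psi>, of q] e q' by simp
qed

lemma spectral_rho_sum:
  assumes \<psi>: "state \<psi>" and I: "finite I" and s: "spectral I (rho \<psi> I) Q r"
  shows "(\<Sum>q\<in>Q. r q) = 1"
proof -
  have "of_real (\<Sum>q\<in>Q. r q) = mtr I (rho \<psi> I)"
    using spectral_moment[OF s, of 1] by simp
  also have "\<dots> = 1" using ev_rho[OF \<psi> I, of 1] ev_one[OF \<psi>] by simp
  finally show ?thesis by (metis of_real_eq_1_iff)
qed

section \<open>The norm\<close>

definition n2 :: "'g::countable la \<Rightarrow> real" where
  "n2 x = sqrt (hs x)"

lemma n2_nonneg [simp]: "n2 x \<ge> 0"
  by (simp add: n2_def)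

lemma n2_square: "(n2 x)\<^sup>2 = hs x"
  by (simp add: n2_def)

lemma n2_sc: "n2 (sc a x) = cmod a * n2 x"
proof -
  have "hs (sc a x) = (cmod a)\<^sup>2 * hs x"
  proof -
    have "tr (star (sc a x) * sc a x) = (a * cnj a) * of_real (hs x)" by (simp add: tr_star_hs)
    also have "\<dots> = of_real ((cmod a)\<^sup>2 * hs x)" by (simp only: complex_norm_square[symmetric] of_real_mult)
    finally show ?thesis unfolding hs_def[of "sc a x"] by (simp only: Re_complex_of_real)
  qed
  then show ?thesis by (simp add: n2_def real_sqrt_mult)
qed

lemma n2_L2_set:
  assumes "finite W" "\<And>S. coef x S \<noteq> 0 \<Longrightarrow> S \<in> W" "\<And>S. S \<in> W \<Longrightarrow> finite S"
  shows "n2 x = L2_set (\<lambda>S. cmod (coef x S)) W"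
  using tr_star_mult[OF assms] by (simp add: n2_def hs_def L2_set_def)

lemma n2_add: "n2 (x + y) \<le> n2 x + n2 y"
proof -
  let ?W = "{S. coef x S \<noteq> 0} \<union> {S. coef y S \<noteq> 0}"
  have W: "finite ?W" "\<And>S. S \<in> ?W \<Longrightarrow> finite S"
    using coef_support_finite coef_infinite by auto
  have "n2 (x + y) = L2_set (\<lambda>S. cmod (coef x S + coef y S)) ?W"
    using W by (subst n2_L2_set[of ?W]) auto
  also have "\<dots> \<le> L2_set (\<lambda>S. cmod (coef x S) + cmod (coef y S)) ?W"
    by (intro L2_set_mono norm_triangle_ineq) auto
  also have "\<dots> \<le> L2_set (\<lambda>S. cmod (coef x S)) ?W + L2_set (\<lambda>S. cmod (coef y S)) ?W"
    by (rule L2_set_triangle_ineq)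
  also have "\<dots> = n2 x + n2 y"
  proof -
    have "n2 x = L2_set (\<lambda>S. cmod (coef x S)) ?W" by (rule n2_L2_set[OF W(1) _ W(2)]) auto
    moreover have "n2 y = L2_set (\<lambda>S. cmod (coef y S)) ?W" by (rule n2_L2_set[OF W(1) _ W(2)]) auto
    ultimately show ?thesis by simp
  qed
  finally show ?thesis .
qed

lemma n2_gm_mult: "finite S \<Longrightarrow> n2 (gm S * y) = n2 y"
proof -
  assume S: "finite S"
  have "star (gm S * y) * (gm S * y) = star y * (star (gm S) * gm S) * y" by (simp add: mult.assoc)
  then show ?thesis using S by (simp add: n2_def hs_def)
qed

text \<open>Monomials are unitary, so they act isometrically, and local elements are finite
  combinations of them. The supremum in \<open>cnorm\<close> is therefore over a bounded
  set.\<close>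

lemma n2_mult_bounded: "\<exists>c\<ge>0. \<forall>y. n2 (x * y) \<le> c * n2 y"
proof (induction x rule: la_induct)
  case (add x z)
  then obtain c d where cd: "c \<ge> 0" "d \<ge> 0" "\<forall>y. n2 (x * y) \<le> c * n2 y" "\<forall>y. n2 (z * y) \<le> d * n2 y"
    by blast
  have "n2 ((x + z) * y) \<le> (c + d) * n2 y" for y
    using n2_add[of "x * y" "z * y"] cd(3,4)[rule_format, of y] by (simp add: distrib_right)
  then show ?case using cd by (intro exI[of _ "c + d"]) auto
next
  case (sc a x)
  then obtain c where c: "c \<ge> 0" "\<forall>y. n2 (x * y) \<le> c * n2 y" by blast
  have "n2 (sc a x * y) \<le> (cmod a * c) * n2 y" for y
    using c mult_left_mono[of "n2 (x * y)" "c * n2 y" "cmod a"] by (simp add: n2_sc mult.assoc)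
  then show ?case using c by (intro exI[of _ "cmod a * c"]) auto
next
  case (gm S)
  then show ?case by (intro exI[of _ 1]) (simp add: n2_gm_mult)
qed

section \<open>The operator norm on local elements\<close>

definition cn :: "'g::countable la \<Rightarrow> real" where
  "cn x = cnorm (coef x)"

lemma Collect_loc: "{F y | y. loc y \<and> G y} = {F (coef x) | x. G (coef x)}"
  by (auto; metis loc_iff_coef)

lemma cn_Sup: "cn x = Sup {n2 (x * y) | y. n2 y \<le> 1}"
proof -
  have "{sqrt (Re (tau (cmul (cadj (cmul (coef x) y)) (cmul (coef x) y)))) | y.
      loc y \<and> Re (tau (cmul (cadj y) y)) \<le> 1} = {n2 (x * y) | y. n2 y \<le> 1}" (is "?L = ?R")
  proof -
    have *: "Re (tau (cmul (cadj (coef z)) (coef z))) = hs z" for z :: "'a la"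
      by (simp add: coef_ops tau_def hs_def tr_def)
    have "?L = {sqrt (Re (tau (cmul (cadj (cmul (coef x) (coef y))) (cmul (coef x) (coef y))))) | y.
      Re (tau (cmul (cadj (coef y)) (coef y))) \<le> 1}"
      by (rule Collect_loc)
    also have "\<dots> = ?R"
      unfolding times_la.rep_eq[symmetric] * by (simp add: n2_def)
    finally show ?thesis .
  qed
  then show ?thesis unfolding cn_def cnorm_def by simp
qed

lemma cn_bdd: "bdd_above {n2 (x * y) | y. n2 y \<le> 1}"
proof -
  obtain c where c: "c \<ge> 0" "\<And>y. n2 (x * y) \<le> c * n2 y" using n2_mult_bounded by blast
  have "n2 (x * y) \<le> c" if "n2 y \<le> 1" for y
    using c(2)[of y] mult_left_mono[OF that c(1)] by simp
  then show ?thesis by (intro bdd_aboveI[of _ c]) auto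
qed

lemma n2_mult_le: "n2 (x * y) \<le> cn x * n2 y"
proof (cases "y = 0")
  case True
  then show ?thesis by (simp add: n2_def hs_def)
next
  case False
  then have y: "n2 y > 0"
    using hs_nonneg[of y] hs_eq_0_iff[of y] unfolding n2_def by (simp add: less_le del: hs_eq_0_iff)
  let ?z = "sc (of_real (1 / n2 y)) y"
  have "n2 ?z \<le> 1" using y by (simp add: n2_sc norm_divide)
  then have "n2 (x * ?z) \<le> cn x"
    unfolding cn_Sup by (intro cSup_upper cn_bdd) blast
  then show ?thesis using y by (simp add: n2_sc norm_divide field_simps)
qed

lemma cn_least: "(\<And>y. n2 y \<le> 1 \<Longrightarrow> n2 (x * y) \<le> c) \<Longrightarrow> cn x \<le> c"
  unfolding cn_Sup by (intro cSup_least) (auto intro!: exI[of _ 0] simp: n2_def hs_def)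

lemma cn_add: "cn (x + y) \<le> cn x + cn y"
proof (rule cn_least)
  fix z :: "'a la" assume z: "n2 z \<le> 1"
  have "n2 (x * z) \<le> cn x" "n2 (y * z) \<le> cn y"
    using z unfolding cn_Sup by (auto intro!: cSup_upper cn_bdd)
  then show "n2 ((x + y) * z) \<le> cn x + cn y"
    using n2_add[of "x * z" "y * z"] by (simp add: distrib_right)
qed

lemma cn_minus: "cn (- x) = cn x"
proof -
  have "n2 (- z) = n2 z" for z :: "'a la" by (simp add: n2_def hs_def)
  then show ?thesis by (simp add: cn_Sup)
qed

lemma cn_diff_commute: "cn (x - y) = cn (y - x)"
  using cn_minus[of "x - y"] by simp

lemma cn_diff: "\<bar>cn x - cn y\<bar> \<le> cn (x - y)"
  using cn_add[of "x - y" y] cn_add[of "y - x" x] cn_diff_commute[of x y] by simp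

text \<open>In the eigenprojections of the density matrix, the value at star x * x is an average,
  with weights r q, of the squared lengths of x q relative to q, each at most the squared norm of
  x.\<close>

lemma ev_le_cn:
  assumes \<psi>: "state \<psi>"
  shows "cmod (ev \<psi> x) \<le> cn x"
proof -
  obtain I where I: "finite I" "on_reg I x" using on_reg_exists by blast
  obtain Q r where s: "spectral I (rho \<psi> I) Q r" using spectral_rho_exists[OF \<psi> I(1)] by blast
  have c0: "cn x \<ge> 0"
  proof -
    have "n2 (1 :: 'a la) = 1" by (simp add: n2_def hs_def)
    then show ?thesis using n2_mult_le[of x 1] n2_nonneg[of x] by (simp del: n2_nonneg)
  qed
  have "ev \<psi> (star x * x) = mtr I ((\<Sum>q\<in>Q. sc (of_real (r q)) q) * (star x * x))"
    using ev_rho[OF \<psi> I(1), of "star x * x"] I spectral_expand[OF s] by simp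
  also have "\<dots> = (\<Sum>q\<in>Q. of_real (r q) * mtr I (q * (star x * x)))"
    by (simp add: sum_distrib_right)
  also have "\<dots> = (\<Sum>q\<in>Q. of_real (r q) * of_real (2 ^ card I * hs (x * q)))"
  proof (intro sum.cong refl)
    fix q assume "q \<in> Q"
    then have q: "star q = q" "q * q = q" using s by (auto simp: spectral_def min_proj_def)
    have "mtr I (star (x * q) * (x * q)) = mtr I (q * (q * (star x * x)))"
      using q by (metis mtr_commute star_mult mult.assoc)
    also have "q * (q * (star x * x)) = q * (star x * x)" using q by (simp add: mult.assoc[symmetric])
    finally show "of_real (r q) * mtr I (q * (star x * x)) = of_real (r q) * of_real (2 ^ card I * hs (x * q))"
      by (simp only: mtr_hs)
  qed
  finally have 1: "Re (ev \<psi> (star x * x)) = (\<Sum>q\<in>Q. r q * (2 ^ card I * hs (x * q)))" by simp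
  also have "\<dots> \<le> (\<Sum>q\<in>Q. r q * (cn x)\<^sup>2)"
  proof (intro sum_mono mult_left_mono)
    fix q assume q: "q \<in> Q"
    then have q': "star q = q" "q * q = q" "mtr I q = 1" using s by (auto simp: spectral_def min_proj_def)
    then have "of_real (2 ^ card I * hs q) = (1 :: complex)" using mtr_hs[of I q] by simp
    then have h: "2 ^ card I * hs q = 1" by (metis of_real_eq_1_iff)
    have "hs (x * q) \<le> (cn x)\<^sup>2 * hs q"
      using power_mono[OF n2_mult_le[of x q], of 2] by (simp add: n2_square power_mult_distrib)
    then have "2 ^ card I * hs (x * q) \<le> (cn x)\<^sup>2 * (2 ^ card I * hs q)"
      by simp
    then show "2 ^ card I * hs (x * q) \<le> (cn x)\<^sup>2" using h by simp
    show "r q \<ge> 0" by (rule spectral_rho_eigenvalue[OF \<psi> I(1) s q])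
  qed
  also have "\<dots> = (cn x)\<^sup>2"
    using spectral_rho_sum[OF \<psi> I(1) s] by (simp add: sum_distrib_right[symmetric])
  finally have le: "Re (ev \<psi> (star x * x)) \<le> (cn x)\<^sup>2" .
  \<comment> \<open>Cauchy-Schwarz in the form that the variance of x about its mean ?t is
    nonnegative.\<close>
  let ?t = "ev \<psi> x"
  have "ev \<psi> (star (x - sc ?t 1) * (x - sc ?t 1)) = ev \<psi> (star x * x) - cnj ?t * ?t"
    using \<psi> by (simp add: algebra_simps ev_linear ev_star)
  moreover have "Re (cnj ?t * ?t) = (cmod ?t)\<^sup>2" by (simp add: cmod_power2) (simp add: power2_eq_square)
  ultimately have "(cmod ?t)\<^sup>2 \<le> Re (ev \<psi> (star x * x))"
    using ev_nonneg[OF \<psi>, of "x - sc ?t 1"] by simp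
  then have "(cmod ?t)\<^sup>2 \<le> (cn x)\<^sup>2" using le by simp
  then show ?thesis using c0 by (rule power2_le_imp_le)
qed

section \<open>The product state\<close>

text \<open>gamma_S = csgn (S \<inter> A) (S - A) * gamma_(S \<inter> A) gamma_(S - A) dictates the value of the
  product state on gamma_S.\<close>

definition prod_coeff :: "'g set \<Rightarrow> ('g::countable car \<Rightarrow> complex) \<Rightarrow> ('g \<times> bool) set \<Rightarrow> complex" where
  "prod_coeff A \<phi> S = csgn (S \<inter> A \<times> UNIV) (S - A \<times> UNIV) *
     (ev \<phi> (gm (S \<inter> A \<times> UNIV)) * ev \<phi> (gm (S - A \<times> UNIV)))"

definition prod_fun :: "'g set \<Rightarrow> ('g::countable car \<Rightarrow> complex) \<Rightarrow> 'g la \<Rightarrow> complex" where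
  "prod_fun A \<phi> x = (\<Sum>S | coef x S \<noteq> 0. coef x S * prod_coeff A \<phi> S)"

definition prod_state :: "'g set \<Rightarrow> ('g::countable car \<Rightarrow> complex) \<Rightarrow> 'g car \<Rightarrow> complex" where
  "prod_state A \<phi> f = (if loc f then prod_fun A \<phi> (mk_la f) else 0)"

lemma ev_prod_state: "ev (prod_state A \<phi>) x = prod_fun A \<phi> x"
  by (simp add: ev_def prod_state_def coef_inverse)

lemma prod_fun_superset:
  assumes "finite W" "{S. coef x S \<noteq> 0} \<subseteq> W"
  shows "prod_fun A \<phi> x = (\<Sum>S\<in>W. coef x S * prod_coeff A \<phi> S)"
  unfolding prod_fun_def using assms by (intro sum.mono_neutral_left) auto

lemma prod_fun_add: "prod_fun A \<phi> (x + y) = prod_fun A \<phi> x + prod_fun A \<phi> y"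
proof -
  let ?W = "{S. coef x S \<noteq> 0} \<union> {S. coef y S \<noteq> 0}"
  have "finite ?W" by (simp add: coef_support_finite)
  then show ?thesis
    by (subst (1 2 3) prod_fun_superset[of ?W]) (auto simp: sum.distrib algebra_simps)
qed

lemma prod_fun_sc: "prod_fun A \<phi> (sc a x) = a * prod_fun A \<phi> x"
  by (subst prod_fun_superset[of "{S. coef x S \<noteq> 0}"])
    (auto simp: coef_support_finite prod_fun_def sum_distrib_left mult.assoc)

lemma prod_fun_gm: "finite S \<Longrightarrow> prod_fun A \<phi> (gm S) = prod_coeff A \<phi> S"
  by (subst prod_fun_superset[of "{S}"]) auto

lemma prod_fun_mult:
  assumes \<phi>: "state \<phi>" and X: "on_reg A X" and Y: "on_reg (- A) Y"
  shows "prod_fun A \<phi> (X * Y) = ev \<phi> X * ev \<phi> Y"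
proof (induction X rule: la_support_induct)
  case (gm S)
  then have S: "S \<subseteq> A \<times> UNIV" using X by (auto simp: on_reg_iff)
  show ?case
  proof (induction Y rule: la_support_induct)
    case (gm T)
    then have T: "T \<subseteq> (- A) \<times> UNIV" using Y by (auto simp: on_reg_iff)
    have "symdiff S T \<inter> A \<times> UNIV = S" "symdiff S T - A \<times> UNIV = T"
      using S T by (auto simp: symdiff_def)
    then show ?case
      using \<open>finite S\<close> \<open>finite T\<close> by (simp add: gm_mult prod_fun_sc prod_fun_gm prod_coeff_def)
  next
    case zero
    show ?case using \<phi> prod_fun_sc[of A \<phi> 0 0] by (simp add: ev_linear)
  qed (simp_all add: ev_linear[OF \<phi>] distrib_left prod_fun_add prod_fun_sc)
next
  case zero
  show ?case using \<phi> prod_fun_sc[of A \<phi> 0 0] by (simp add: ev_linear)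
qed (simp_all add: ev_linear[OF \<phi>] distrib_right prod_fun_add prod_fun_sc)

lemma gm_split:
  assumes "finite S"
  shows "gm S = sc (csgn (S \<inter> A \<times> UNIV) (S - A \<times> UNIV)) (gm (S \<inter> A \<times> UNIV) * gm (S - A \<times> UNIV))"
proof -
  have "symdiff (S \<inter> A \<times> UNIV) (S - A \<times> UNIV) = S" by (auto simp: symdiff_def)
  then show ?thesis using assms by (simp add: gm_mult)
qed

lemma mtr_disjoint:
  assumes "on_reg A x" "on_reg L y" "finite A" "finite L" "A \<inter> L = {}"
  shows "mtr (A \<union> L) (x * y) = mtr A x * mtr L y"
  using assms by (simp add: mtr_def tr_mult_disjoint card_Un_disjoint power_add)

text \<open>Evenness moves \<open>rho \<phi> L\<close> past the monomial on A; what results is a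
  product of an element on A and one on L, whose trace factorises.\<close>

lemma prod_density:
  assumes \<phi>: "state \<phi>" "even_state \<phi>" and fin: "finite A" "finite L" and AL: "A \<inter> L = {}"
    and x: "on_reg (A \<union> L) x"
  shows "mtr (A \<union> L) (rho \<phi> A * rho \<phi> L * x) = prod_fun A \<phi> x"
proof (induction x rule: la_support_induct)
  case zero
  show ?case using prod_fun_sc[of A \<phi> 0 0] by simp
next
  case (gm U)
  then have U: "U \<subseteq> (A \<union> L) \<times> UNIV" using x by (auto simp: on_reg_iff)
  let ?S = "U \<inter> A \<times> UNIV" and ?T = "U - A \<times> UNIV"
  have S: "on_reg A (gm ?S)" and T: "on_reg L (gm ?T)" and T': "on_reg (- A) (gm ?T)"
    using U by (auto intro!: on_reg_gm)
  have com: "rho \<phi> L * gm ?S = gm ?S * rho \<phi> L"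
    using even_commute[OF even_rho[OF \<phi> fin(2)] on_reg_rho S] AL by auto
  have "rho \<phi> A * rho \<phi> L * (gm ?S * gm ?T) = rho \<phi> A * (rho \<phi> L * gm ?S) * gm ?T"
    by (simp add: mult.assoc)
  also have "\<dots> = (rho \<phi> A * gm ?S) * (rho \<phi> L * gm ?T)"
    unfolding com by (simp add: mult.assoc)
  finally have "mtr (A \<union> L) (rho \<phi> A * rho \<phi> L * (gm ?S * gm ?T))
      = mtr A (rho \<phi> A * gm ?S) * mtr L (rho \<phi> L * gm ?T)"
    using S T fin AL by (simp add: mtr_disjoint)
  also have "\<dots> = ev \<phi> (gm ?S) * ev \<phi> (gm ?T)"
    using ev_rho[OF \<phi>(1)] S T fin by simp
  also have "\<dots> = prod_fun A \<phi> (gm ?S * gm ?T)"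
    using prod_fun_mult[OF \<phi>(1) S T'] by simp
  finally show ?case
    unfolding gm_split[OF \<open>finite U\<close>, of A] by (simp add: prod_fun_sc)
qed (simp_all add: prod_fun_add prod_fun_sc distrib_left)

text \<open>Eigenprojections of even matrices need not be even, so q and p may fail to commute and q
  p need not be a projection. The density is therefore written as a nonnegative combination of the
  elements q p q, which are positive in any case.\<close>

lemma prod_fun_nonneg:
  assumes \<phi>: "state \<phi>" "even_state \<phi>" and A: "finite A"
  shows "\<exists>t\<ge>0. prod_fun A \<phi> (star x * x) = complex_of_real t"
proof -
  obtain I where I: "finite I" "on_reg I x" using on_reg_exists by blast
  define L where "L = I - A"
  let ?J = "A \<union> L"
  have L: "finite L" "A \<inter> L = {}" using I by (auto simp: L_def)
  have x: "on_reg ?J x" using I(2) by (rule on_reg_mono) (auto simp: L_def)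
  obtain Q r where Q: "spectral A (rho \<phi> A) Q r" using spectral_rho_exists[OF \<phi>(1) A] by blast
  obtain P s where P: "spectral L (rho \<phi> L) P s" using spectral_rho_exists[OF \<phi>(1) L(1)] by blast
  have q: "on_reg A q" "star q = q" "q * q = q" if "q \<in> Q" for q
    using Q that by (auto simp: spectral_def min_proj_def)
  have p: "star p = p" "p * p = p" if "p \<in> P" for p
    using P that by (auto simp: spectral_def min_proj_def)
  have "rho \<phi> A * rho \<phi> L = (\<Sum>q\<in>Q. sc (of_real (r q)) (q * rho \<phi> L))"
    by (subst spectral_expand[OF Q]) (simp add: sum_distrib_right)
  \<comment> \<open>The whole matrix \<open>rho \<phi> L\<close> is even and commutes with each q;
    the sandwich is formed before it is split into its own projections.\<close>
  also have "\<dots> = (\<Sum>q\<in>Q. sc (of_real (r q)) (q * rho \<phi> L * q))"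
  proof (intro sum.cong refl)
    fix q assume "q \<in> Q"
    then have "rho \<phi> L * q = q * rho \<phi> L"
      using even_commute[OF even_rho[OF \<phi> L(1)] on_reg_rho q(1)] L(2) by auto
    then have "q * rho \<phi> L * q = q * q * rho \<phi> L" by (simp add: mult.assoc)
    then show "sc (of_real (r q)) (q * rho \<phi> L) = sc (of_real (r q)) (q * rho \<phi> L * q)"
      using q \<open>q \<in> Q\<close> by simp
  qed
  also have "\<dots> = (\<Sum>q\<in>Q. \<Sum>p\<in>P. sc (of_real (r q * s p)) (q * p * q))"
    by (subst spectral_expand[OF P]) (simp add: sum_distrib_left sum_distrib_right sc_sum)
  finally have rr: "rho \<phi> A * rho \<phi> L = (\<Sum>q\<in>Q. \<Sum>p\<in>P. sc (of_real (r q * s p)) (q * p * q))" .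
  have pos: "mtr ?J (q * p * q * (star x * x)) = of_real (2 ^ card ?J * hs (x * q * p))"
    if "q \<in> Q" "p \<in> P" for q p
  proof -
    have "mtr ?J (star (x * q * p) * (x * q * p)) = mtr ?J (p * (q * (star x * x) * q * p))"
      using q(2)[OF that(1)] p(1)[OF that(2)] by (simp add: mult.assoc)
    also have "\<dots> = mtr ?J ((q * (star x * x)) * (q * p * p))"
      by (subst mtr_commute) (simp add: mult.assoc)
    also have "\<dots> = mtr ?J ((q * p * p) * (q * (star x * x)))" by (rule mtr_commute)
    also have "(q * p * p) * (q * (star x * x)) = q * p * q * (star x * x)"
      using p(2)[OF that(2)] by (simp add: mult.assoc)
    finally show ?thesis by (simp only: mtr_hs)
  qed
  have "prod_fun A \<phi> (star x * x) = mtr ?J (rho \<phi> A * rho \<phi> L * (star x * x))"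
    using prod_density[OF \<phi> A L] x by simp
  also have "\<dots> = (\<Sum>q\<in>Q. \<Sum>p\<in>P. of_real (r q * s p) * mtr ?J (q * p * q * (star x * x)))"
    unfolding rr by (simp add: sum_distrib_right mult.assoc)
  also have "\<dots> = (\<Sum>q\<in>Q. \<Sum>p\<in>P. of_real (r q * s p) * of_real (2 ^ card ?J * hs (x * q * p)))"
    by (intro sum.cong refl) (simp only: pos)
  also have "\<dots> = of_real (\<Sum>q\<in>Q. \<Sum>p\<in>P. (r q * s p) * (2 ^ card ?J * hs (x * q * p)))"
    by simp
  finally have "prod_fun A \<phi> (star x * x)
      = of_real (\<Sum>q\<in>Q. \<Sum>p\<in>P. (r q * s p) * (2 ^ card ?J * hs (x * q * p)))" .
  moreover have "(\<Sum>q\<in>Q. \<Sum>p\<in>P. (r q * s p) * (2 ^ card ?J * hs (x * q * p))) \<ge> 0"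
    using spectral_rho_eigenvalue(2)[OF \<phi>(1) A Q] spectral_rho_eigenvalue(2)[OF \<phi>(1) L(1) P]
    by (intro sum_nonneg mult_nonneg_nonneg) auto
  ultimately show ?thesis by blast
qed

lemma state_prod_state:
  assumes \<phi>: "state \<phi>" "even_state \<phi>" and A: "finite A"
  shows "state (prod_state A \<phi>)"
proof -
  have la: "loc f \<longleftrightarrow> (\<exists>x. f = coef x)" for f :: "'a car" by (rule loc_iff_coef)
  have e: "prod_state A \<phi> (coef x) = prod_fun A \<phi> x" for x
    using ev_prod_state[of A \<phi> x] by (simp add: ev_def)
  have "prod_fun A \<phi> 1 = 1"
    using prod_fun_mult[OF \<phi>(1), of A 1 1] ev_one[OF \<phi>(1)] by simp
  moreover have "Im (prod_fun A \<phi> (star x * x)) = 0 \<and> Re (prod_fun A \<phi> (star x * x)) \<ge> 0" for x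
    using prod_fun_nonneg[OF assms, of x] by auto
  ultimately show ?thesis
    unfolding state_def
    by (intro conjI allI impI; (elim la[THEN iffD1, elim_format] exE)?)
      (auto simp: coef_ops e prod_fun_add prod_fun_sc prod_state_def coef_inverse)
qed

text \<open>Uniqueness: each monomial is, up to sign, a product of one on A and one off A, so the
  product rule fixes all values on local elements.\<close>

lemma car_prod_eq:
  assumes \<phi>: "state \<phi>" "even_state \<phi>" and A: "finite A"
  shows "car_prod A \<phi> \<phi> = prod_state A \<phi>"
  unfolding car_prod_def
proof (rule the_equality)
  have "prod_state A \<phi> (cmul X Y) = \<phi> X * \<phi> Y" if "in_alg A X" "in_alg (- A) Y" for X Y
  proof -
    obtain x where x: "X = coef x" "on_reg A x" using \<open>in_alg A X\<close> by (rule in_algE)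
    obtain y where y: "Y = coef y" "on_reg (- A) y" using \<open>in_alg (- A) Y\<close> by (rule in_algE)
    show ?thesis
      using prod_fun_mult[OF \<phi>(1) x(2) y(2)] ev_prod_state[of A \<phi> "x * y"]
      by (simp add: x(1) y(1) coef_ops ev_def)
  qed
  then show "state (prod_state A \<phi>) \<and> (\<forall>X Y. in_alg A X \<longrightarrow> in_alg (- A) Y \<longrightarrow>
      prod_state A \<phi> (cmul X Y) = \<phi> X * \<phi> Y)"
    using state_prod_state[OF assms] by blast
next
  fix \<omega> assume \<omega>: "state \<omega> \<and> (\<forall>X Y. in_alg A X \<longrightarrow> in_alg (- A) Y \<longrightarrow> \<omega> (cmul X Y) = \<phi> X * \<phi> Y)"
  then have s: "state \<omega>" by blast
  have prod: "ev \<omega> (x * y) = ev \<phi> x * ev \<phi> y" if "on_reg A x" "on_reg (- A) y" for x y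
    using \<omega> that by (simp add: ev_def times_la.rep_eq in_alg_coef)
  have "ev \<omega> x = prod_fun A \<phi> x" for x
  proof (induction x rule: la_induct)
    case (gm S)
    have "on_reg A (gm (S \<inter> A \<times> UNIV))" "on_reg (- A) (gm (S - A \<times> UNIV))"
      by (auto intro!: on_reg_gm)
    then have "ev \<omega> (gm (S \<inter> A \<times> UNIV) * gm (S - A \<times> UNIV))
        = prod_fun A \<phi> (gm (S \<inter> A \<times> UNIV) * gm (S - A \<times> UNIV))"
      using prod prod_fun_mult[OF \<phi>(1)] by simp
    then show ?case
      unfolding gm_split[OF gm, of A] by (simp add: ev_sc[OF s] prod_fun_sc)
  qed (simp_all add: ev_linear[OF s] prod_fun_add prod_fun_sc)
  then have "\<omega> f = prod_state A \<phi> f" if "loc f" for f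
    using that ev_prod_state[of A \<phi>] unfolding loc_iff_coef ev_def by auto
  \<comment> \<open>Both functions take the default value 0 there, which makes them equal as
    functions.\<close>
  moreover have "\<omega> f = prod_state A \<phi> f" if "\<not> loc f" for f
    using that s by (simp add: state_def prod_state_def)
  ultimately show "\<omega> = prod_state A \<phi>" by blast
qed

lemma ev_prod_state_left:
  assumes "state \<phi>" "on_reg A x"
  shows "ev (prod_state A \<phi>) x = ev \<phi> x"
  using prod_fun_mult[OF assms, of 1] ev_one[OF assms(1)] by (simp add: ev_prod_state)

lemma ev_prod_state_right:
  assumes "state \<phi>" "on_reg (- A) x"
  shows "ev (prod_state A \<phi>) x = ev \<phi> x"
  using prod_fun_mult[OF assms(1) _ assms(2), of 1] ev_one[OF assms(1)] by (simp add: ev_prod_state)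

section \<open>Entropy of the product state\<close>

lemma power_mult_commuting:
  fixes x y :: "'a::monoid_mult"
  assumes "x * y = y * x"
  shows "(x * y) ^ n = x ^ n * y ^ n"
proof (induction n)
  case (Suc n)
  have "y * x ^ n = x ^ n * y" using assms by (metis power_commuting_commutes)
  then have "x * y * (x ^ n * y ^ n) = x * (x ^ n * y) * y ^ n" by (metis mult.assoc)
  then show ?case by (simp add: Suc mult.assoc)
qed simp

lemma eta_mult: "x \<ge> 0 \<Longrightarrow> y \<ge> 0 \<Longrightarrow> eta (x * y) = eta x * y + x * eta y"
  by (auto simp: eta_def ln_mult algebra_simps)

text \<open>The marginals commute and live on disjoint regions, so the moments of their product
  factorise. Hence its spectrum is the family of products r q * s p, and no joint eigenprojections
  have to be constructed.\<close>

lemma vN_entropy_prod_state: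
  assumes \<phi>: "state \<phi>" "even_state \<phi>" and fin: "finite A" "finite L" and AL: "A \<inter> L = {}"
  shows "vN_entropy (prod_state A \<phi>) (A \<union> L) = vN_entropy \<phi> A + vN_entropy \<phi> L"
proof -
  let ?w = "prod_state A \<phi>" and ?J = "A \<union> L"
  have w: "state ?w" by (rule state_prod_state[OF \<phi> fin(1)])
  have J: "finite ?J" using fin by simp
  obtain Q r where Q: "spectral A (rho \<phi> A) Q r" using spectral_rho_exists[OF \<phi>(1) fin(1)] by blast
  obtain P s where P: "spectral L (rho \<phi> L) P s" using spectral_rho_exists[OF \<phi>(1) fin(2)] by blast
  have reg: "on_reg ?J (rho \<phi> A)" "on_reg ?J (rho \<phi> L)"
    by (rule on_reg_mono[OF on_reg_rho]; simp)+
  have R: "rho ?w ?J = rho \<phi> A * rho \<phi> L"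
    by (rule rho_unique[OF w J, symmetric])
      (use reg prod_density[OF \<phi> fin AL] in \<open>simp_all add: ev_prod_state\<close>)
  have com: "rho \<phi> A * rho \<phi> L = rho \<phi> L * rho \<phi> A"
    by (rule even_commute[OF even_rho[OF \<phi> fin(1)] on_reg_rho on_reg_rho AL])
  have mom: "mtr ?J (rho ?w ?J ^ n) = of_real (\<Sum>k\<in>Q \<times> P. (r (fst k) * s (snd k)) ^ n)" for n
  proof -
    have "mtr ?J (rho ?w ?J ^ n) = mtr A (rho \<phi> A ^ n) * mtr L (rho \<phi> L ^ n)"
      unfolding R power_mult_commuting[OF com] using fin AL by (intro mtr_disjoint) simp_all
    also have "\<dots> = of_real ((\<Sum>q\<in>Q. r q ^ n) * (\<Sum>p\<in>P. s p ^ n))"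
      by (simp only: spectral_moment[OF Q] spectral_moment[OF P] of_real_mult)
    also have "(\<Sum>q\<in>Q. r q ^ n) * (\<Sum>p\<in>P. s p ^ n) = (\<Sum>k\<in>Q \<times> P. (r (fst k) * s (snd k)) ^ n)"
      by (simp add: sum_product sum.cartesian_product power_mult_distrib case_prod_unfold)
    finally show ?thesis .
  qed
  have QP: "finite Q" "finite P" using Q P by (auto simp: spectral_def)
  have "vN_entropy ?w ?J = (\<Sum>k\<in>Q \<times> P. eta (r (fst k) * s (snd k)))"
    using vN_entropy_moments[OF w J _ mom] QP by simp
  also have "\<dots> = (\<Sum>q\<in>Q. \<Sum>p\<in>P. eta (r q * s p))"
    by (simp add: sum.cartesian_product case_prod_unfold)
  also have "\<dots> = (\<Sum>q\<in>Q. \<Sum>p\<in>P. eta (r q) * s p + r q * eta (s p))"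
    using spectral_rho_eigenvalue(2)[OF \<phi>(1) fin(1) Q] spectral_rho_eigenvalue(2)[OF \<phi>(1) fin(2) P]
    by (intro sum.cong refl eta_mult) auto
  also have "\<dots> = (\<Sum>q\<in>Q. eta (r q)) * (\<Sum>p\<in>P. s p) + (\<Sum>q\<in>Q. r q) * (\<Sum>p\<in>P. eta (s p))"
    by (simp add: sum.distrib sum_product)
  also have "\<dots> = vN_entropy \<phi> A + vN_entropy \<phi> L"
    using spectral_rho_sum[OF \<phi>(1) fin(1) Q] spectral_rho_sum[OF \<phi>(1) fin(2) P]
      vN_entropy_spectral[OF \<phi>(1) fin(1) Q] vN_entropy_spectral[OF \<phi>(1) fin(2) P] by simp
  finally show ?thesis .
qed

lemma vN_entropy_cong:
  assumes "state \<psi>" "state \<phi>" "finite I" "\<And>x. on_reg I x \<Longrightarrow> ev \<psi> x = ev \<phi> x"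
  shows "vN_entropy \<psi> I = vN_entropy \<phi> I"
proof -
  have "rho \<psi> I = rho \<phi> I"
    unfolding rho_def using assms(4) by (intro sum.cong refl) simp
  then have "dens \<psi> I = dens \<phi> I" using assms by (simp add: dens_eq_rho)
  then show ?thesis by (simp add: vN_entropy_def dens_spec_def)
qed

section \<open>Lower bound for the conditional entropy\<close>

text \<open>The partial trace in coefficients: both sides carry the same values of the state, and
  2^(-|A|) is the ratio of the normalisations on A \<union> L and on L.\<close>

lemma restr_rho:
  assumes "finite A" "finite L" "A \<inter> L = {}"
  shows "restr (- A) (rho \<phi> (A \<union> L)) = sc (1 / 2 ^ card A) (rho \<phi> L)"
proof (rule la_eqI)
  fix S :: "('a \<times> bool) set"
  have "S \<subseteq> (- A) \<times> UNIV \<and> S \<subseteq> (A \<union> L) \<times> UNIV \<longleftrightarrow> S \<subseteq> L \<times> UNIV" using assms(3) by auto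
  then show "coef (restr (- A) (rho \<phi> (A \<union> L))) S = coef (sc (1 / 2 ^ card A) (rho \<phi> L)) S"
    using assms by (auto simp: coef_rho card_Un_disjoint power_add)
qed

text \<open>The term S = {} of the average over monomials gamma_S on A is dominated by the whole sum.\<close>

lemma pinching_bound:
  assumes \<phi>: "state \<phi>" "even_state \<phi>" and fin: "finite A" "finite L" and AL: "A \<inter> L = {}"
    and y: "on_reg (A \<union> L) y"
  shows "Re (ev \<phi> (star y * y)) \<le> 2 ^ card A * Re (mtr (A \<union> L) (rho \<phi> L * (star y * y)))"
proof -
  let ?J = "A \<union> L" and ?W = "Pow (A \<times> (UNIV :: bool set))"
  have J: "finite ?J" using fin by simp
  have W: "finite ?W" using fin by simp
  have "complex_of_real (2 ^ card A) * mtr ?J (rho \<phi> L * (star y * y))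
      = mtr ?J (sc (4 ^ card A) (restr (- A) (rho \<phi> ?J)) * (star y * y))"
  proof -
    \<comment> \<open>The number of conjugating monomials times the factor from the partial
      trace.\<close>
    have "(4::complex) ^ card A * (1 / 2 ^ card A) = 2 ^ card A"
      by (simp add: field_simps flip: power_mult_distrib)
    then show ?thesis unfolding restr_rho[OF fin AL] by simp
  qed
  also have "\<dots> = (\<Sum>S\<in>?W. mtr ?J (gm S * rho \<phi> ?J * star (gm S) * (star y * y)))"
    unfolding twirl[OF fin(1) even_rho[OF \<phi> J], symmetric] by (simp add: sum_distrib_right)
  also have "\<dots> = (\<Sum>S\<in>?W. ev \<phi> (star (y * gm S) * (y * gm S)))"
  proof (intro sum.cong refl)
    fix S assume "S \<in> ?W"
    then have S: "on_reg ?J (gm S)" by (intro on_reg_gm) auto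
    have "mtr ?J (gm S * rho \<phi> ?J * star (gm S) * (star y * y))
        = mtr ?J (rho \<phi> ?J * star (gm S) * (star y * y) * gm S)"
      by (simp add: mult.assoc mtr_commute[of _ "gm S"])
    also have "\<dots> = mtr ?J (rho \<phi> ?J * (star (y * gm S) * (y * gm S)))" by (simp add: mult.assoc)
    also have "\<dots> = ev \<phi> (star (y * gm S) * (y * gm S))"
      using S y by (intro ev_rho[OF \<phi>(1) J]) simp
    finally show "mtr ?J (gm S * rho \<phi> ?J * star (gm S) * (star y * y))
        = ev \<phi> (star (y * gm S) * (y * gm S))" .
  qed
  finally have "2 ^ card A * Re (mtr ?J (rho \<phi> L * (star y * y)))
      = (\<Sum>S\<in>?W. Re (ev \<phi> (star (y * gm S) * (y * gm S))))"
    by (simp only: Re_sum[symmetric]) (metis scaleR_conv_of_real scaleR_complex.sel(1))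
  also have "\<dots> \<ge> Re (ev \<phi> (star (y * gm {}) * (y * gm {})))"
    by (rule member_le_sum[OF _ _ W, of "{}"]) (auto intro: ev_nonneg[OF \<phi>(1)] simp del: star_mult)
  finally show ?thesis by simp
qed

text \<open>The overlaps of the two families of eigenprojections turn both entropies into averages
  over one joint distribution of eigenvalue pairs. The scalar bound for the logarithm is applied
  pair by pair, and \<open>pinching_bound\<close> controls the resulting expectations of the inverse
  density matrix.\<close>

lemma cond_entropy_lower_bound:
  assumes \<phi>: "state \<phi>" "even_state \<phi>" and fin: "finite A" "finite L" and AL: "A \<inter> L = {}"
  shows "vN_entropy \<phi> (A \<union> L) - vN_entropy \<phi> L \<ge> - (real (card A) * ln 2)"
proof -
  let ?J = "A \<union> L"
  define c :: real where "c = 2 ^ card A"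
  have c: "c > 0" by (simp add: c_def)
  have J: "finite ?J" using fin by simp
  obtain Q r where Q: "spectral ?J (rho \<phi> ?J) Q r" using spectral_rho_exists[OF \<phi>(1) J] by blast
  obtain P s where P: "spectral L (rho \<phi> L) P s" using spectral_rho_exists[OF \<phi>(1) fin(2)] by blast
  have fQP: "finite Q" "finite P" and one: "\<Sum>Q = 1" "\<Sum>P = 1"
    using Q P by (auto simp: spectral_def)
  have q: "on_reg ?J q" "star q = q" "q * q = q" "mtr ?J q = 1"
    "\<And>x. on_reg ?J x \<Longrightarrow> q * x * q = sc (mtr ?J (q * x)) q" if "q \<in> Q" for q
    using Q that by (auto simp: spectral_def min_proj_def)
  have p: "on_reg L p" "star p = p" "p * p = p" if "p \<in> P" for p
    using P that by (auto simp: spectral_def min_proj_def)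
  have pJ: "on_reg ?J p" if "p \<in> P" for p
    using p(1)[OF that] by (rule on_reg_mono) simp
  have orth: "p * p' = 0" if "p \<in> P" "p' \<in> P" "p \<noteq> p'" for p p'
    using P that by (auto simp: spectral_def)
  have r0: "r q \<ge> 0" if "q \<in> Q" for q using spectral_rho_eigenvalue(2)[OF \<phi>(1) J Q that] .
  have s0: "s p \<ge> 0" if "p \<in> P" for p using spectral_rho_eigenvalue(2)[OF \<phi>(1) fin(2) P that] .
  \<comment> \<open>The probability of p in the pure state of q, written as a squared length so that
    it is evidently nonnegative. On A \<union> L the projection p has rank 2^|A|, so in general only
    the sums over p equal 1.\<close>
  define D where "D q p = 2 ^ card ?J * hs (q * p)" for q p :: "'a la"
  have D0: "D q p \<ge> 0" for q p by (simp add: D_def)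
  have D: "mtr ?J (q * p) = of_real (D q p)" if "q \<in> Q" "p \<in> P" for q p
  proof -
    have "mtr ?J (star (q * p) * (q * p)) = mtr ?J (p * (q * p))"
      using q(2,3)[OF that(1)] p(2)[OF that(2)] by (simp add: mult.assoc) (simp add: mult.assoc[symmetric])
    also have "\<dots> = mtr ?J (q * p)"
      using p(3)[OF that(2)] by (subst mtr_commute) (simp add: mult.assoc)
    finally show ?thesis unfolding D_def mtr_hs by simp
  qed
  have D1: "(\<Sum>p\<in>P. D q p) = 1" if "q \<in> Q" for q
  proof -
    have "of_real (\<Sum>p\<in>P. D q p) = mtr ?J (q * \<Sum>P)"
      using D[OF that] by (simp add: sum_distrib_left)
    also have "\<dots> = 1" using one q(4)[OF that] by simp
    finally show ?thesis by (metis of_real_eq_1_iff)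
  qed
  have Ds: "(\<Sum>q\<in>Q. r q * D q p) = s p" if "p \<in> P" for p
  proof -
    have "of_real (\<Sum>q\<in>Q. r q * D q p) = mtr ?J ((\<Sum>q\<in>Q. sc (of_real (r q)) q) * p)"
      using D[OF _ that] by (simp add: sum_distrib_right)
    also have "\<dots> = ev \<phi> p"
      using ev_rho[OF \<phi>(1) J pJ[OF that]] spectral_expand[OF Q] by simp
    also have "\<dots> = of_real (s p)" by (rule spectral_rho_eigenvalue[OF \<phi>(1) fin(2) P that])
    finally show ?thesis by (metis of_real_eq_iff)
  qed
  \<comment> \<open>The inverse of the density matrix of L on its support (1 / 0 = 0).\<close>
  define X where "X = (\<Sum>p\<in>P. sc (of_real (1 / s p)) p)"
  have X: "on_reg ?J X" "star X = X"
    using pJ p by (auto simp: X_def intro!: sum.cong)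
  have Xp: "X * p = sc (of_real (1 / s p)) p" if "p \<in> P" for p
  proof -
    have "X * p = (\<Sum>p'\<in>P. if p' = p then sc (of_real (1 / s p)) p else 0)"
      unfolding X_def sum_distrib_right
      using p(3)[OF that] orth[OF _ that] by (intro sum.cong refl) auto
    then show ?thesis using fQP that by (simp add: sum.delta)
  qed
  \<comment> \<open>The quotient is 1 or, where s p = 0, equal to 0; the product is the support
    projection of \<open>rho \<phi> L\<close> and is absorbed by X.\<close>
  have rX: "rho \<phi> L * X = (\<Sum>p\<in>P. sc (of_real (s p / s p)) p)"
  proof -
    have "rho \<phi> L * p = sc (of_real (s p)) p" if "p \<in> P" for p
      using P that by (auto simp: spectral_def)
    then show ?thesis by (auto simp: X_def sum_distrib_left intro!: sum.cong)
  qed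
  have "X * (rho \<phi> L * X) = (\<Sum>p\<in>P. sc (of_real (s p / s p * (1 / s p))) p)"
    unfolding rX using Xp by (simp add: sum_distrib_left)
  also have "\<dots> = X"
    unfolding X_def by (intro sum.cong refl) auto
  finally have XrX: "X * (rho \<phi> L * X) = X" .
  \<comment> \<open>The expectation of X in the pure state of q.\<close>
  define t where "t q = (\<Sum>p\<in>P. D q p / s p)" for q
  have t: "mtr ?J (q * X) = of_real (t q)" if "q \<in> Q" for q
    using D[OF that] by (simp add: X_def t_def sum_distrib_left)
  have t0: "t q \<ge> 0" if "q \<in> Q" for q
    unfolding t_def using D0 s0 by (intro sum_nonneg) auto
  \<comment> \<open>r tr(qX)^2 = r tr(qXqX) \<le> \<phi>(XqX) \<le> c tr(\<rho> XqX) = c tr(qX), with \<rho> the density matrix of L.\<close>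
  have key: "r q * t q \<le> c" if qQ: "q \<in> Q" for q
  proof (cases "t q = 0")
    case False
    then have tp: "t q > 0" using t0[OF qQ] by simp
    let ?y = "q * X"
    have y: "star ?y * ?y = X * (q * X)"
      using q(2,3)[OF qQ] X(2) by (simp add: mult.assoc) (simp add: mult.assoc[symmetric])
    have yJ: "on_reg ?J ?y" using q(1)[OF qQ] X(1) by simp
    have "ev \<phi> (star ?y * ?y) = mtr ?J ((\<Sum>q'\<in>Q. sc (of_real (r q')) q') * (star ?y * ?y))"
      using ev_rho[OF \<phi>(1) J on_reg_mult[OF on_reg_star[OF yJ] yJ]] spectral_expand[OF Q] by simp
    also have "\<dots> = (\<Sum>q'\<in>Q. of_real (r q') * mtr ?J (q' * (star ?y * ?y)))"
      by (simp add: sum_distrib_right)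
    also have "\<dots> = (\<Sum>q'\<in>Q. of_real (r q') * of_real (2 ^ card ?J * hs (?y * q')))"
    proof (intro sum.cong refl)
      fix q' assume q': "q' \<in> Q"
      have "mtr ?J (star (?y * q') * (?y * q')) = mtr ?J (q' * (star ?y * ?y * q'))"
        using q(2)[OF q'] by (simp add: mult.assoc)
      also have "\<dots> = mtr ?J (q' * q' * (star ?y * ?y))"
        by (subst mtr_commute) (metis mtr_commute mult.assoc)
      finally show "of_real (r q') * mtr ?J (q' * (star ?y * ?y)) =
          of_real (r q') * complex_of_real (2 ^ card ?J * hs (?y * q'))"
        using q(3)[OF q'] by (simp only: mtr_hs)
    qed
    finally have e: "Re (ev \<phi> (star ?y * ?y)) = (\<Sum>q'\<in>Q. r q' * (2 ^ card ?J * hs (?y * q')))" by simp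
    have "complex_of_real (2 ^ card ?J * hs (?y * q)) = of_real (t q) * of_real (t q)"
    proof -
      have yq: "?y * q = sc (of_real (t q)) q"
        using q(5)[OF qQ X(1)] t[OF qQ] by simp
      have "mtr ?J (star (?y * q) * (?y * q)) = of_real (t q) * of_real (t q)"
        unfolding yq using q(2-4)[OF qQ] by simp
      then show ?thesis by (simp only: mtr_hs)
    qed
    then have "2 ^ card ?J * hs (?y * q) = t q * t q"
      by (metis of_real_eq_iff of_real_mult)
    \<comment> \<open>Of the nonnegative sum over q' only the term q' = q is kept.\<close>
    then have "r q * (t q * t q) \<le> Re (ev \<phi> (star ?y * ?y))"
      unfolding e using member_le_sum[OF qQ, of "\<lambda>q'. r q' * (2 ^ card ?J * hs (?y * q'))"] r0 fQP by simp
    also have "\<dots> \<le> c * Re (mtr ?J (rho \<phi> L * (star ?y * ?y)))"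
      using pinching_bound[OF \<phi> fin AL yJ] by (simp only: c_def)
    also have "mtr ?J (rho \<phi> L * (star ?y * ?y)) = mtr ?J (q * (X * (rho \<phi> L * X)))"
      unfolding y by (metis mtr_commute mult.assoc)
    also have "\<dots> = of_real (t q)" using XrX t[OF qQ] by simp
    finally have "r q * t q * t q \<le> c * t q" by simp
    then show ?thesis using tp by simp
  qed (use c in simp)
  \<comment> \<open>The weights r q * D q p have marginals r and s, so both entropies can be
    averaged over the same pairs and compared term by term.\<close>
  have SL: "vN_entropy \<phi> L = - (\<Sum>q\<in>Q. \<Sum>p\<in>P. r q * D q p * ln (s p))"
  proof -
    have "vN_entropy \<phi> L = (\<Sum>p\<in>P. - (s p * ln (s p)))"
      using vN_entropy_spectral[OF \<phi>(1) fin(2) P] by (simp add: eta_def) (intro sum.cong refl, simp)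
    also have "\<dots> = (\<Sum>p\<in>P. - (\<Sum>q\<in>Q. r q * D q p * ln (s p)))"
      by (intro sum.cong refl) (simp add: Ds[symmetric] sum_distrib_right)
    also have "\<dots> = - (\<Sum>q\<in>Q. \<Sum>p\<in>P. r q * D q p * ln (s p))"
      by (subst sum.swap) (simp add: sum_negf)
    finally show ?thesis .
  qed
  have SJ: "vN_entropy \<phi> ?J = - (\<Sum>q\<in>Q. \<Sum>p\<in>P. r q * D q p * ln (r q))"
  proof -
    have "vN_entropy \<phi> ?J = (\<Sum>q\<in>Q. - (r q * ln (r q)))"
      using vN_entropy_spectral[OF \<phi>(1) J Q] by (simp add: eta_def) (intro sum.cong refl, simp)
    also have "\<dots> = (\<Sum>q\<in>Q. - (\<Sum>p\<in>P. r q * D q p * ln (r q)))"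
    proof (intro sum.cong refl)
      fix q assume "q \<in> Q"
      have "(\<Sum>p\<in>P. r q * D q p * ln (r q)) = (\<Sum>p\<in>P. D q p) * (r q * ln (r q))"
        by (simp add: sum_distrib_left sum_distrib_right mult_ac)
      then show "- (r q * ln (r q)) = - (\<Sum>p\<in>P. r q * D q p * ln (r q))"
        using D1[OF \<open>q \<in> Q\<close>] by simp
    qed
    finally show ?thesis by (simp add: sum_negf)
  qed
  \<comment> \<open>From ln u \<le> u - 1 at u = r q / (s p * c).\<close>
  have summand: "r q * D q p * ln (r q) - r q * D q p * ln (s p)
      \<le> r q / c * (r q * (D q p / s p)) + (ln c - 1) * (r q * D q p)" if "q \<in> Q" "p \<in> P" for q p
  proof (cases "r q * D q p = 0")
    case False
    then have rD: "r q > 0" "D q p > 0" using r0[OF that(1)] D0[of q p] by (auto simp: less_le)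
    \<comment> \<open>The right-hand side is s p, so a positive weight forces s p > 0 and the
      logarithm of the quotient splits.\<close>
    have "r q * D q p \<le> (\<Sum>q\<in>Q. r q * D q p)"
      using fQP r0 D0 that by (intro member_le_sum) auto
    then have s: "s p > 0" using Ds[OF that(2)] mult_pos_pos[OF rD] by linarith
    have "ln (r q / (s p * c)) \<le> r q / (s p * c) - 1"
      using rD s c by (intro ln_le_minus_one) simp
    then have "ln (r q) - ln (s p) \<le> r q / (s p * c) - 1 + ln c"
      using rD s c by (simp add: ln_div ln_mult)
    then have "r q * D q p * (ln (r q) - ln (s p)) \<le> r q * D q p * (r q / (s p * c) - 1 + ln c)"
      using rD by (intro mult_left_mono) auto
    then show ?thesis by (simp add: algebra_simps)
  qed (auto simp: algebra_simps)
  have "vN_entropy \<phi> L - vN_entropy \<phi> ?J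
      = (\<Sum>q\<in>Q. \<Sum>p\<in>P. r q * D q p * ln (r q) - r q * D q p * ln (s p))"
    unfolding SL SJ by (simp add: sum_subtractf)
  also have "\<dots> \<le> (\<Sum>q\<in>Q. \<Sum>p\<in>P. r q / c * (r q * (D q p / s p)) + (ln c - 1) * (r q * D q p))"
    by (intro sum_mono summand)
  also have "\<dots> = (\<Sum>q\<in>Q. r q / c * (r q * t q) + (ln c - 1) * r q)"
  proof (intro sum.cong refl)
    fix q assume "q \<in> Q"
    have "(\<Sum>p\<in>P. r q / c * (r q * (D q p / s p)) + (ln c - 1) * (r q * D q p))
        = r q / c * (r q * t q) + (ln c - 1) * (r q * (\<Sum>p\<in>P. D q p))"
      by (simp only: sum.distrib sum_distrib_left t_def)
    then show "(\<Sum>p\<in>P. r q / c * (r q * (D q p / s p)) + (ln c - 1) * (r q * D q p))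
        = r q / c * (r q * t q) + (ln c - 1) * r q"
      using D1[OF \<open>q \<in> Q\<close>] by simp
  qed
  \<comment> \<open>After \<open>key\<close>, the first term is r q and cancels against the -1 of
    the logarithmic bound, leaving r q * ln c.\<close>
  also have "\<dots> \<le> (\<Sum>q\<in>Q. r q / c * c + (ln c - 1) * r q)"
    using key r0 c by (intro sum_mono add_right_mono mult_left_mono) auto
  also have "\<dots> = (\<Sum>q\<in>Q. r q) * ln c"
    unfolding sum_distrib_right using c by (intro sum.cong refl) (simp add: algebra_simps)
  also have "\<dots> = real (card A) * ln 2"
    using spectral_rho_sum[OF \<phi>(1) J Q] by (simp add: c_def ln_realpow)
  finally show ?thesis by simp
qed

section \<open>Surface energies\<close>

definition psum :: "('g set \<Rightarrow> 'g car) \<Rightarrow> 'g set set \<Rightarrow> 'g la" where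
  "psum \<Phi> F = (\<Sum>K\<in>F. mk_la (\<Phi> K))"

lemma coef_potential:
  assumes "even_potential \<Phi>" "finite K"
  shows "coef (mk_la (\<Phi> K)) = \<Phi> K" "on_reg K (mk_la (\<Phi> K))"
proof -
  have "in_alg K (\<Phi> K)" using assms by (simp add: even_potential_def)
  then show "coef (mk_la (\<Phi> K)) = \<Phi> K" "on_reg K (mk_la (\<Phi> K))"
    by (simp_all add: in_alg_def coef_mk_la on_reg_def)
qed

lemma csum_eq_psum:
  assumes "even_potential \<Phi>" "\<And>K. K \<in> F \<Longrightarrow> finite K"
  shows "csum F \<Phi> = coef (psum \<Phi> F)"
  using assms by (auto simp: csum_def psum_def fun_eq_iff coef_potential intro!: sum.cong)

lemma cdiff_coef: "cdiff (coef x) (coef y) = coef (x - y)"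
  by (simp add: minus_la.rep_eq)

text \<open>The surface energy is known only as a Cauchy net of local elements. A map that is
  1-Lipschitz for the norm carries it to a Cauchy filter in a complete space, so no element of the
  completion has to be formed. States and the norm itself are such maps.\<close>

lemma surface_net_converges:
  fixes f :: "'g::countable la \<Rightarrow> 'b::complete_space"
  assumes pot: "even_potential \<Phi>" and bd: "bd_exists \<Phi> A"
    and f: "\<And>x y. dist (f x) (f y) \<le> cn (x - y)"
  shows "\<exists>c. ((\<lambda>F. f (psum \<Phi> F)) \<longlongrightarrow> c) (finite_subsets_at_top (bd_sets A))"
proof -
  let ?N = "finite_subsets_at_top (bd_sets A)"
  have fin: "K \<in> F \<Longrightarrow> finite K" if "F \<subseteq> bd_sets A" for F K
    using that by (auto simp: bd_sets_def)
  have "cauchy_filter (filtermap (\<lambda>F. f (psum \<Phi> F)) ?N)"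
    unfolding cauchy_filter_metric_filtermap
  proof (intro allI impI)
    fix e :: real assume "e > 0"
    then obtain F0 where F0: "finite F0" "F0 \<subseteq> bd_sets A"
      "\<And>F1 F2. finite F1 \<and> F0 \<subseteq> F1 \<and> F1 \<subseteq> bd_sets A \<and> finite F2 \<and> F0 \<subseteq> F2 \<and> F2 \<subseteq> bd_sets A \<Longrightarrow>
        cnorm (cdiff (csum F1 \<Phi>) (csum F2 \<Phi>)) < e"
      using bd unfolding bd_exists_def by meson
    let ?P = "\<lambda>F. finite F \<and> F0 \<subseteq> F \<and> F \<subseteq> bd_sets A"
    have "dist (f (psum \<Phi> F1)) (f (psum \<Phi> F2)) < e" if "?P F1 \<and> ?P F2" for F1 F2
    proof -
      have "csum F1 \<Phi> = coef (psum \<Phi> F1)" "csum F2 \<Phi> = coef (psum \<Phi> F2)"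
        using that fin by (auto intro!: csum_eq_psum[OF pot])
      then have "cn (psum \<Phi> F1 - psum \<Phi> F2) < e"
        using F0(3)[of F1 F2] that by (simp add: cdiff_coef cn_def)
      then show ?thesis using f[of "psum \<Phi> F1" "psum \<Phi> F2"] by simp
    qed
    moreover have "eventually ?P ?N"
      unfolding eventually_finite_subsets_at_top using F0 by (intro exI[of _ F0]) auto
    ultimately show "\<exists>P. eventually P ?N \<and> (\<forall>F1 F2. P F1 \<and> P F2 \<longrightarrow>
        dist (f (psum \<Phi> F1)) (f (psum \<Phi> F2)) < e)" by (intro exI[of _ ?P]) blast
  qed
  then obtain c where "filtermap (\<lambda>F. f (psum \<Phi> F)) ?N \<le> nhds c"
    using cauchy_filter_complete_converges[of "filtermap (\<lambda>F. f (psum \<Phi> F)) ?N" UNIV] complete_UNIV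
    by (auto simp: filtermap_bot_iff)
  then show ?thesis unfolding filterlim_def by blast
qed

text \<open>\<open>Lim\<close> denotes the limit only once convergence is established; this ties the
  defining expression to the convergent net.\<close>

lemma surface_net_Lim:
  fixes g :: "'g::countable car \<Rightarrow> 'b::complete_space"
  assumes pot: "even_potential \<Phi>" and bd: "bd_exists \<Phi> A"
    and g: "\<And>x y. dist (g (coef x)) (g (coef y)) \<le> cn (x - y)"
  shows "((\<lambda>F. g (coef (psum \<Phi> F))) \<longlongrightarrow>
      Lim (finite_subsets_at_top (bd_sets A)) (\<lambda>F. g (csum F \<Phi>))) (finite_subsets_at_top (bd_sets A))"
proof -
  let ?N = "finite_subsets_at_top (bd_sets A)"
  obtain c where c: "((\<lambda>F. g (coef (psum \<Phi> F))) \<longlongrightarrow> c) ?N"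
    using surface_net_converges[of \<Phi> A "\<lambda>x. g (coef x)", OF pot bd g] by (elim exE) (rule that)
  have "eventually (\<lambda>F. g (coef (psum \<Phi> F)) = g (csum F \<Phi>)) ?N"
  proof (rule eventually_finite_subsets_at_top_weakI)
    fix F assume "F \<subseteq> bd_sets A"
    then have "csum F \<Phi> = coef (psum \<Phi> F)" by (intro csum_eq_psum[OF pot]) (auto simp: bd_sets_def)
    then show "g (coef (psum \<Phi> F)) = g (csum F \<Phi>)" by simp
  qed
  then have "((\<lambda>F. g (csum F \<Phi>)) \<longlongrightarrow> c) ?N" by (rule Lim_transform_eventually[OF c])
  then have "Lim ?N (\<lambda>F. g (csum F \<Phi>)) = c" by (intro tendsto_Lim) auto
  with c show ?thesis by simp
qed

lemma state_bd_tendsto: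
  assumes "even_potential \<Phi>" "bd_exists \<Phi> A" "state \<psi>"
  shows "((\<lambda>F. ev \<psi> (psum \<Phi> F)) \<longlongrightarrow> state_bd \<Phi> \<psi> A) (finite_subsets_at_top (bd_sets A))"
proof -
  have "dist (\<psi> (coef x)) (\<psi> (coef y)) \<le> cn (x - y)" for x y
    using ev_le_cn[OF assms(3), of "x - y"] unfolding ev_diff[OF assms(3)]
    by (simp add: dist_norm ev_def)
  then show ?thesis
    using surface_net_Lim[OF assms(1,2), of \<psi>] by (simp add: state_bd_def ev_def)
qed

lemma norm_bd_tendsto:
  assumes "even_potential \<Phi>" "bd_exists \<Phi> A"
  shows "((\<lambda>F. cn (psum \<Phi> F)) \<longlongrightarrow> norm_bd \<Phi> A) (finite_subsets_at_top (bd_sets A))"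
proof -
  have "dist (cnorm (coef x)) (cnorm (coef y)) \<le> cn (x - y)" for x y :: "'a la"
    using cn_diff[of x y] by (simp add: dist_real_def cn_def)
  then show ?thesis
    using surface_net_Lim[OF assms, of cnorm] by (simp add: norm_bd_def cn_def)
qed

lemma state_bd_diff_le:
  assumes pot: "even_potential \<Phi>" "bd_exists \<Phi> A" and st: "state \<omega>" "state \<phi>"
  shows "Re (state_bd \<Phi> \<omega> A - state_bd \<Phi> \<phi> A) \<le> 2 * norm_bd \<Phi> A"
proof (rule tendsto_le)
  let ?N = "finite_subsets_at_top (bd_sets A)"
  show "((\<lambda>F. 2 * cn (psum \<Phi> F)) \<longlongrightarrow> 2 * norm_bd \<Phi> A) ?N"
    by (intro tendsto_intros norm_bd_tendsto pot)
  show "((\<lambda>F. Re (ev \<omega> (psum \<Phi> F) - ev \<phi> (psum \<Phi> F))) \<longlongrightarrow> Re (state_bd \<Phi> \<omega> A - state_bd \<Phi> \<phi> A)) ?N"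
    by (intro tendsto_intros state_bd_tendsto pot st)
  have "Re (ev \<omega> x - ev \<phi> x) \<le> 2 * cn x" for x
    using ev_le_cn[OF st(1), of x] ev_le_cn[OF st(2), of x]
      abs_Re_le_cmod[of "ev \<omega> x"] abs_Re_le_cmod[of "ev \<phi> x"] by simp
  then show "\<forall>\<^sub>F F in ?N. Re (ev \<omega> (psum \<Phi> F) - ev \<phi> (psum \<Phi> F)) \<le> 2 * cn (psum \<Phi> F)" by simp
qed simp

section \<open>The bound on the mutual information\<close>

lemma mutual_info_mono:
  assumes \<phi>: "state \<phi>" "even_state \<phi>" and A: "finite A" and B: "B \<subseteq> - A"
  shows "mutual_info \<phi> A B \<le> mutual_info \<phi> A (- A)"
proof -
  have "cond_entropy \<phi> A (- A) \<le> cond_entropy \<phi> A B"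
    unfolding cond_entropy_def
  proof (rule cINF_superset_mono)
    have "- (real (card A) * ln 2) \<le> vN_entropy \<phi> (A \<union> L) - vN_entropy \<phi> L"
      if "finite L" "L \<subseteq> - A" for L
      using that by (intro cond_entropy_lower_bound[OF \<phi> A]) auto
    then show "bdd_below ((\<lambda>L. vN_entropy \<phi> (A \<union> L) - vN_entropy \<phi> L) ` {L. finite L \<and> L \<subseteq> - A})"
      by (intro bdd_belowI2[of _ "- (real (card A) * ln 2)"]) auto
  qed (use B in auto)
  then show ?thesis by (simp add: mutual_info_def)
qed

text \<open>Additivity makes every finite L contribute the same difference, so the infimum is over a
  single value.\<close>

lemma cond_entropy_prod_state:
  assumes \<phi>: "state \<phi>" "even_state \<phi>" and A: "finite A"
  shows "cond_entropy (prod_state A \<phi>) A (- A) = vN_entropy \<phi> A"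
proof -
  let ?w = "prod_state A \<phi>"
  have w: "state ?w" by (rule state_prod_state[OF assms])
  have "vN_entropy ?w (A \<union> L) - vN_entropy ?w L = vN_entropy \<phi> A" if L: "finite L" "L \<subseteq> - A" for L
  proof -
    have "vN_entropy ?w L = vN_entropy \<phi> L"
      using L by (intro vN_entropy_cong[OF w \<phi>(1)] ev_prod_state_right[OF \<phi>(1)]) (auto intro: on_reg_mono)
    moreover have "vN_entropy ?w (A \<union> L) = vN_entropy \<phi> A + vN_entropy \<phi> L"
      using L by (intro vN_entropy_prod_state[OF \<phi> A]) auto
    ultimately show ?thesis by simp
  qed
  then have "(\<lambda>L. vN_entropy ?w (A \<union> L) - vN_entropy ?w L) ` {L. finite L \<and> L \<subseteq> - A} = {vN_entropy \<phi> A}"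
    by (auto simp: image_iff intro!: exI[of _ "{}"])
  then show ?thesis unfolding cond_entropy_def by simp
qed

text \<open>All terms of the inner energy live on A, where the two states agree; it cancels in the
  comparison of free energies.\<close>

lemma ev_H_loc_prod_state:
  assumes "even_potential \<Phi>" "state \<phi>" "finite A"
  shows "prod_state A \<phi> (H_loc \<Phi> A) = \<phi> (H_loc \<Phi> A)"
proof -
  have "H_loc \<Phi> A = coef (psum \<Phi> (Pow A))"
    unfolding H_loc_def using assms by (intro csum_eq_psum) (auto intro: finite_subset)
  moreover have "on_reg A (psum \<Phi> (Pow A))"
    unfolding psum_def
  proof (intro on_reg_sum)
    fix K assume "K \<in> Pow A"
    then have "finite K" "K \<subseteq> A" using assms(3) finite_subset by auto
    then show "on_reg A (mk_la (\<Phi> K))"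
      using coef_potential(2)[OF assms(1)] on_reg_mono by blast
  qed
  ultimately show ?thesis
    using ev_prod_state_left[OF assms(2)] by (simp add: ev_def)
qed

theorem theorem2:
  fixes \<Phi> :: "'g::countable set \<Rightarrow> 'g car"
    and \<phi> :: "'g car \<Rightarrow> complex"
    and \<beta> :: real
    and A B :: "'g set"
  assumes "infinite (UNIV :: 'g set)"
    and "even_potential \<Phi>"
    and "\<forall>I. finite I \<longrightarrow> bd_exists \<Phi> I"
    and "state \<phi>"
    and "\<beta> > 0"
    and "LTS \<Phi> \<beta> \<phi>"
    and "even_state \<phi>"
    and "finite A"
    and "B \<subseteq> - A"
  shows "mutual_info \<phi> A B \<le> mutual_info \<phi> A (- A)
    \<and> mutual_info \<phi> A (- A) \<le> \<beta> * Re (state_bd \<Phi> (car_prod A \<phi> \<phi>) A - state_bd \<Phi> \<phi> A)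
    \<and> \<beta> * Re (state_bd \<Phi> (car_prod A \<phi> \<phi>) A - state_bd \<Phi> \<phi> A) \<le> 2 * \<beta> * norm_bd \<Phi> A"
proof (intro conjI)
  let ?w = "prod_state A \<phi>"
  note cp = car_prod_eq[OF assms(4,7,8)]
  have w: "state ?w" by (rule state_prod_state[OF assms(4,7,8)])
  show "mutual_info \<phi> A B \<le> mutual_info \<phi> A (- A)"
    by (rule mutual_info_mono[OF assms(4,7,8,9)])
  have "?w x = \<phi> x" if "in_alg (- A) x" for x
    using in_algE[OF that] ev_prod_state_right[OF assms(4)] by (metis ev_def)
  then have "free_energy \<Phi> \<beta> A \<phi> \<le> free_energy \<Phi> \<beta> A ?w"
    using assms(6,8) w unfolding LTS_def by blast
  then have "vN_entropy \<phi> A / \<beta> - cond_entropy \<phi> A (- A) / \<beta>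
      \<le> Re (state_bd \<Phi> ?w A - state_bd \<Phi> \<phi> A)"
    unfolding free_energy_def ev_H_loc_prod_state[OF assms(2,4,8)]
      cond_entropy_prod_state[OF assms(4,7,8)] by simp
  then have "(vN_entropy \<phi> A - cond_entropy \<phi> A (- A)) / \<beta> \<le> Re (state_bd \<Phi> ?w A - state_bd \<Phi> \<phi> A)"
    by (simp only: diff_divide_distrib)
  then show "mutual_info \<phi> A (- A) \<le> \<beta> * Re (state_bd \<Phi> (car_prod A \<phi> \<phi>) A - state_bd \<Phi> \<phi> A)"
    unfolding cp mutual_info_def using assms(5) by (simp only: pos_divide_le_eq mult.commute)
  have "Re (state_bd \<Phi> ?w A - state_bd \<Phi> \<phi> A) \<le> 2 * norm_bd \<Phi> A"
    using assms(3,8) by (intro state_bd_diff_le[OF assms(2) _ w assms(4)]) blast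
  then show "\<beta> * Re (state_bd \<Phi> (car_prod A \<phi> \<phi>) A - state_bd \<Phi> \<phi> A) \<le> 2 * \<beta> * norm_bd \<Phi> A"
    unfolding cp using mult_left_mono[OF _ less_imp_le[OF assms(5)]] by (simp only: mult.assoc mult.left_commute)
qed

end
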